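(* For every positive integer $n$ divisible by $4$, there is a normal element $\alpha$ of $\mathbb{F}_{2^n}$ over $\mathbb{F}_2$ such that the Hamming weight of its corresponding vector $$\left(\mathrm{Tr}_{2^n|2}(\alpha),\ \mathrm{Tr}_{2^n|2}(\alpha^{1+2}),\ \mathrm{Tr}_{2^n|2}(\alpha^{1+4}),\ \ldots,\ \mathrm{Tr}_{2^n|2}(\alpha^{1+2^{n-1}})\right)\in\mathbb{F}_2^n$$ is $3$.
   Context: An element $\alpha\in\mathbb{F}_{2^n}$ is a normal element of $\mathbb{F}_{2^n}$ over $\mathbb{F}_2$ if $\{\alpha,\alpha^2,\alpha^{2^2},\ldots,\alpha^{2^{n-1}}\}$ is a basis of $\mathbb{F}_{2^n}$ over $\mathbb{F}_2$. The trace function is $\mathrm{Tr}_{2^n|2}(x)=\sum_{i=0}^{n-1}x^{2^i}$. The corresponding vector of $\alpha$ is the vector with entries $\mathrm{Tr}_{2^n|2}(\alpha\cdot\alpha^{2^i})$, $0\leq i\leq n-1$ (the entry for $i=0$ is $\mathrm{Tr}_{2^n|2}(\alpha^2)=\mathrm{Tr}_{2^n|2}(\alpha)$). The Hamming weight of a vector is its number of nonzero entries. *)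

theory Defs
  imports
    "HOL-Computational_Algebra.Computational_Algebra"
    "HOL-Number_Theory.Number_Theory"
    "HOL-Library.Z2"
begin

text \<open>
  The field with \<open>2 ^ n\<close> elements is an arbitrary type \<open>'a\<close> of class \<^class>\<open>finite_field\<close>
  with \<open>card (UNIV :: 'a set) = 2 ^ n\<close>. The field with two elements is \<^typ>\<open>bit\<close>, acting on
  \<open>'a\<close> by \<open>0 \<cdot> x = 0\<close> and \<open>1 \<cdot> x = x\<close>; this is a vector space structure because \<open>'a\<close> has
  characteristic 2.
\<close>

definition scale2 :: "bit \<Rightarrow> 'a :: finite_field \<Rightarrow> 'a" where
  "scale2 c x = (if c = 0 then 0 else x)"

lemma card_eq_power2_imp_CHAR:
  assumes "card (UNIV :: 'a :: finite_field set) = 2 ^ n"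
  shows "CHAR('a) = 2"
proof -
  have "CHAR('a) dvd 2 ^ n"
    using CHAR_dvd_CARD[where 'a = 'a] assms by simp
  thus ?thesis
    by (metis CHAR_prime prime_dvd_power primes_dvd_imp_eq two_is_prime_nat)
qed

lemma vector_space_scale2:
  assumes "card (UNIV :: 'a :: finite_field set) = 2 ^ n"
  shows "vector_space (scale2 :: bit \<Rightarrow> 'a \<Rightarrow> 'a)"
proof -
  have "2 = (0 :: 'a)"
    using card_eq_power2_imp_CHAR[OF assms] of_nat_CHAR[where 'a = 'a] by simp
  hence "x + x = 0" for x :: 'a
    by (simp flip: mult_2)
  thus ?thesis
    by unfold_locales (auto simp: scale2_def)
qed

definition normal_element :: "nat \<Rightarrow> 'a :: finite_field \<Rightarrow> bool" where
  "normal_element n \<alpha> \<longleftrightarrow>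
     (let B = {\<alpha> ^ (2 ^ i) | i. i < n}
      in \<not> module.dependent scale2 B \<and> module.span scale2 B = UNIV)"

definition trace2 :: "nat \<Rightarrow> 'a :: finite_field \<Rightarrow> 'a" where
  "trace2 n x = (\<Sum>i<n. x ^ (2 ^ i))"

text \<open>
  Traces lie in the prime field \<open>{0, 1}\<close>; they are kept as elements of \<open>'a\<close>.
\<close>

lemma trace2_in_prime_field:
  assumes "card (UNIV :: 'a :: finite_field set) = 2 ^ n"
  shows "trace2 n (x :: 'a) \<in> {0, 1}"
proof -
  have CH: "CHAR('a) = 2"
    by (rule card_eq_power2_imp_CHAR[OF assms])
  have two: "2 = (0 :: 'a)"
    using CH of_nat_CHAR[where 'a = 'a] by simp
  have add_sq: "(a + b) ^ 2 = a ^ 2 + b ^ 2" for a b :: 'a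
    by (simp add: power2_sum two)
  have "(\<Sum>i<m. x ^ (2 ^ i)) ^ 2 = (\<Sum>i<m. x ^ (2 ^ Suc i))" for m
    by (induction m) (simp_all add: add_sq mult.commute flip: power_mult)
  hence "trace2 n x ^ 2 + x = (\<Sum>i<Suc n. x ^ (2 ^ i))"
    unfolding trace2_def by (subst sum.lessThan_Suc_shift) simp
  also have "\<dots> = trace2 n x + x"
    using finite_field_power_card_eq_same[of x] assms by (simp add: trace2_def)
  finally have "trace2 n x * (trace2 n x - 1) = 0"
    by (simp add: power2_eq_square algebra_simps)
  thus ?thesis by auto
qed

definition corresponding_vector :: "nat \<Rightarrow> 'a :: finite_field \<Rightarrow> 'a list" where
  "corresponding_vector n \<alpha> = map (\<lambda>i. trace2 n (\<alpha> * \<alpha> ^ (2 ^ i))) [0..<n]"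

definition hamming_weight :: "'a :: zero list \<Rightarrow> nat" where
  "hamming_weight v = length (filter (\<lambda>x. x \<noteq> 0) v)"

end

theory Submission
  imports Defs
begin

text \<open>
  Write \<open>n = N m\<close> with \<open>N = 2 ^ s\<close>, \<open>s \<ge> 2\<close> and \<open>m\<close> odd, and take \<open>\<alpha> = \<beta> \<gamma>\<close> with \<open>\<beta>\<close> in the subfield of
  degree \<open>N\<close> and \<open>\<gamma>\<close> in the subfield of degree \<open>m\<close>. The trace of a product of elements of the two
  subfields is the product of the traces, so it suffices that \<open>\<gamma>\<close> generates a self-dual normal basis
  and that the corresponding vector of \<open>\<beta>\<close> has weight 3.

  Viewing the corresponding vector as an element \<open>c\<close> of the group algebra of a cyclic group, replacing
  an element by its image under \<open>g\<close> multiplies \<open>c\<close> by \<open>g g\<^sup>*\<close>. For odd \<open>m\<close> the group algebra is reduced,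
  so \<open>c\<close> times the square of a symmetric power of \<open>c\<close> is idempotent; an element whose \<open>c\<close> is a maximal
  idempotent has \<open>c = 1\<close>, since the trace form restricted to the complementary summand is not alternating.
  For \<open>N = 2 ^ s\<close> put \<open>Z = X + X\<^sup>-\<^sup>1\<close>. Every \<open>c\<close> coming from an element of trace 1 is congruent to
  \<open>1 + Z\<close> modulo \<open>Z\<^sup>2\<close>, and the norms \<open>g g\<^sup>*\<close> of \<open>g = 1 + (1 + X) Z\<^sup>a\<close>, \<open>a \<ge> 1\<close>, let one correct the
  coefficients of \<open>Z\<^sup>2\<close>, \<open>Z\<^sup>3\<close>, ... one at a time until \<open>c = 1 + X + X\<^sup>-\<^sup>1\<close>.
\<close>

section \<open>Binary polynomials acting through the Frobenius\<close>

hide_const (open) UnivPoly.coeff UnivPoly.monom Module.smult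

definition frob :: "nat \<Rightarrow> 'a :: finite_field \<Rightarrow> 'a" where
  "frob k u = u ^ (2 ^ k)"

definition fixed_field :: "nat \<Rightarrow> 'a :: finite_field set" where
  "fixed_field k = {u. frob k u = u}"

text \<open>Linear extension of \<open>X^i\<close> to \<open>g i\<close>. With
  \<open>g i = frob i u\<close> it evaluates a polynomial at the Frobenius map; with a sequence of
  trace values it is a pairing.\<close>

definition lin :: "(nat \<Rightarrow> 'a :: finite_field) \<Rightarrow> bit poly \<Rightarrow> 'a" where
  "lin g p = (\<Sum>i\<le>degree p. scale2 (coeff p i) (g i))"

definition act :: "bit poly \<Rightarrow> 'a :: finite_field \<Rightarrow> 'a" where
  "act p u = lin (\<lambda>i. frob i u) p"

definition trace_form :: "nat \<Rightarrow> 'a :: finite_field \<Rightarrow> 'a \<Rightarrow> 'a" where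
  "trace_form N u v = trace2 N (u * v)"

text \<open>For \<open>u\<close>, \<open>v\<close> in \<open>fixed_field N\<close> the traces are 0
  or 1 but have type \<open>'a\<close>, so they are recast as bits.\<close>

definition corr :: "nat \<Rightarrow> 'a :: finite_field \<Rightarrow> 'a \<Rightarrow> bit poly" where
  "corr N u v = (\<Sum>k<N. monom (if trace_form N u (frob k v) = 0 then 0 else 1) k)"

text \<open>Acts as the relative trace from degree \<open>m * r\<close> down to degree
  \<open>m\<close>.\<close>

definition rel_trace :: "nat \<Rightarrow> nat \<Rightarrow> bit poly" where
  "rel_trace m r = (\<Sum>j<r. monom 1 (m * j))"

text \<open>The type argument only fixes the field in which \<open>act\<close> is taken.\<close>

definition adjoint :: "'a :: finite_field itself \<Rightarrow> nat \<Rightarrow> bit poly \<Rightarrow> bit poly \<Rightarrow> bool" where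
  "adjoint _ N p q \<longleftrightarrow> (\<forall>v \<in> fixed_field N. \<forall>w \<in> fixed_field N.
     trace_form N (act p v) w = trace_form N v (act q w :: 'a))"

text \<open>\<open>recip N\<close> represents \<open>X + X\<^sup>-\<^sup>1\<close> modulo \<open>X ^ N + 1\<close>.\<close>

definition recip :: "nat \<Rightarrow> bit poly" where
  "recip N = monom 1 1 + monom 1 (N - 1)"

text \<open>The second clause is evenness, written without negative indices.\<close>

definition palindromic :: "nat \<Rightarrow> (nat \<Rightarrow> 'b) \<Rightarrow> bool" where
  "palindromic N c \<longleftrightarrow> (\<forall>i j. [i = j] (mod N) \<longrightarrow> c i = c j) \<and> (\<forall>i j. N dvd i + j \<longrightarrow> c i = c j)"

text \<open>For palindromic \<open>c\<close> this is the coefficient of \<open>X^k\<close> in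
  \<open>Z^m c\<close>: as \<open>Z\<close> is symmetric, pairing agrees with convolution.\<close>

definition recip_coeff :: "nat \<Rightarrow> (nat \<Rightarrow> 'a :: finite_field) \<Rightarrow> nat \<Rightarrow> nat \<Rightarrow> 'a" where
  "recip_coeff N c m k = lin c (recip N ^ m * monom 1 k)"

text \<open>The coefficients of \<open>1 + X + X^-1\<close> modulo \<open>X^N + 1\<close>, extended
  periodically.\<close>

definition weight3_pattern :: "nat \<Rightarrow> nat \<Rightarrow> 'a :: finite_field" where
  "weight3_pattern N i = (if i mod N \<in> {0, 1, N - 1} then 1 else 0)"

section \<open>Frobenius powers and their fixed fields\<close>

lemma frob_0 [simp]: "frob 0 u = u" and frob_zero [simp]: "frob k 0 = 0"
  and frob_one [simp]: "frob k 1 = 1"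
  by (simp_all add: frob_def)

lemma frob_1: "frob (Suc 0) u = u ^ 2"
  by (simp add: frob_def)

lemma frob_frob: "frob i (frob j u) = frob (i + j) u"
  by (simp add: frob_def power_add mult.commute flip: power_mult)

lemma frob_mult: "frob k (u * v) = frob k u * frob k v"
  by (simp add: frob_def power_mult_distrib)

lemma trace2_frob: "trace2 N u = (\<Sum>i<N. frob i u)"
  by (simp add: trace2_def frob_def)

lemma fixed_field_times: "u \<in> fixed_field N \<Longrightarrow> v \<in> fixed_field N \<Longrightarrow> u * v \<in> fixed_field N"
  by (simp add: fixed_field_def frob_mult)

lemma fixed_field_frob: "u \<in> fixed_field N \<Longrightarrow> frob k u \<in> fixed_field N"
  by (simp add: fixed_field_def frob_frob) (metis add.commute frob_frob)

lemma fixed_field_0 [simp]: "0 \<in> fixed_field N" and fixed_field_1 [simp]: "1 \<in> fixed_field N"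
  by (simp_all add: fixed_field_def)

lemma frob_mult_period:
  assumes "u \<in> fixed_field N"
  shows "frob (N * k) u = u"
proof (induction k)
  case (Suc k)
  have "frob (N * Suc k) u = frob (N * k) (frob N u)"
    by (simp add: frob_frob add.commute)
  also have "\<dots> = u" using Suc assms by (simp add: fixed_field_def)
  finally show ?case .
qed simp

lemma frob_mod:
  assumes "u \<in> fixed_field N"
  shows "frob (k mod N) u = frob k u"
proof -
  have "frob k u = frob (k mod N) (frob (N * (k div N)) u)"
    by (simp add: frob_frob)
  thus ?thesis using frob_mult_period[OF assms] by simp
qed

lemma frob_cong:
  assumes "u \<in> fixed_field N" "[j = k] (mod N)"
  shows "frob j u = frob k u"
  by (metis assms cong_def frob_mod)

lemma scale2_0 [simp]: "scale2 0 x = 0" and scale2_1 [simp]: "scale2 1 x = x"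
  and scale2_zero [simp]: "scale2 a 0 = 0"
  by (simp_all add: scale2_def)

lemma scale2_add_right: "scale2 a (x + y) = scale2 a x + scale2 a y"
  by (simp add: scale2_def)

lemma lin_eq:
  assumes "degree p \<le> D"
  shows "lin g p = (\<Sum>i\<le>D. scale2 (coeff p i) (g i))"
  unfolding lin_def using assms
  by (intro sum.mono_neutral_left) (auto simp: coeff_eq_0)

lemma lin_0 [simp]: "lin g 0 = 0"
  by (simp add: lin_def)

lemma lin_pCons: "lin g (pCons a p) = scale2 a (g 0) + lin (\<lambda>i. g (Suc i)) p"
proof -
  have "lin g (pCons a p) = (\<Sum>i\<le>Suc (degree p). scale2 (coeff (pCons a p) i) (g i))"
    by (rule lin_eq) (simp add: degree_pCons_le)
  also have "\<dots> = scale2 a (g 0) + (\<Sum>i\<le>degree p. scale2 (coeff p i) (g (Suc i)))"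
    by (subst sum.atMost_Suc_shift) simp
  finally show ?thesis by (simp add: lin_def)
qed

lemma lin_1 [simp]: "lin g 1 = g 0"
  by (simp add: one_pCons lin_pCons)

lemma lin_monom: "lin g (monom a k) = scale2 a (g k)"
  by (induction k arbitrary: g) (simp_all add: monom_0 monom_Suc lin_pCons)

lemma lin_fun_add: "lin (\<lambda>i. g i + h i) p = lin g p + lin h p"
  by (simp add: lin_def scale2_add_right sum.distrib)

lemma additive_lin:
  assumes "h 0 = 0" "\<And>x y. h (x + y) = h x + h y"
  shows "h (lin g p) = lin (\<lambda>i. h (g i)) p"
proof -
  have s: "h (sum f A) = (\<Sum>x\<in>A. h (f x))" for f :: "nat \<Rightarrow> 'b" and A
    by (induction A rule: infinite_finite_induct) (simp_all add: assms)
  show ?thesis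
    by (simp add: lin_def s scale2_def if_distrib[of h] assms(1) cong: if_cong)
qed

lemma sum_lessThan_Suc_period:
  fixes f :: "nat \<Rightarrow> 'b :: cancel_comm_monoid_add"
  assumes "f N = f 0"
  shows "(\<Sum>i<N. f (Suc i)) = (\<Sum>i<N. f i)"
  using sum.lessThan_Suc_shift[of f N] assms by (simp add: add.commute)

lemma bij_betw_mult_mod:
  fixes a b :: nat
  assumes "coprime a b" "b > 0"
  shows "bij_betw (\<lambda>j. a * j mod b) {..<b} {..<b}"
proof -
  have "inj_on (\<lambda>j. a * j mod b) {..<b}"
  proof (rule inj_onI)
    fix i j assume ij: "i \<in> {..<b}" "j \<in> {..<b}" "a * i mod b = a * j mod b"
    hence "[i = j] (mod b)" using cong_mult_lcancel_nat[OF assms(1)] by (simp add: cong_def)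
    thus "i = j" using ij by (simp add: cong_def)
  qed
  moreover have "(\<lambda>j. a * j mod b) ` {..<b} \<subseteq> {..<b}" using assms(2) by auto
  ultimately show ?thesis
    by (simp add: bij_betw_def card_image card_subset_eq)
qed

lemma trace_form_commute: "trace_form N u v = trace_form N v u"
  by (simp add: trace_form_def mult.commute)

lemma coeff_corr: "k < N \<Longrightarrow> coeff (corr N u v) k = (if trace_form N u (frob k v) = 0 then 0 else 1)"
  by (simp add: corr_def coeff_sum)

lemma degree_corr: "N > 0 \<Longrightarrow> degree (corr N u v) < N"
  unfolding corr_def
  by (rule degree_sum_less) (auto intro: le_less_trans[OF degree_monom_le])

section \<open>Binary polynomials modulo \<open>X^N + 1\<close>\<close>

lemma bit_poly_add_self: "p + p = (0 :: bit poly)"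
proof -
  have "(2 :: bit poly) = [:2:]" by (metis of_nat_numeral of_nat_poly)
  thus ?thesis by (simp flip: mult_2 add: numeral_poly)
qed

lemma freshmans_dream_bit_poly: "(p + q) ^ (2 ^ t) = p ^ (2 ^ t) + q ^ (2 ^ t)" for p q :: "bit poly"
proof (induction t)
  case (Suc t)
  have "(a + b)\<^sup>2 = a\<^sup>2 + b\<^sup>2" for a b :: "bit poly"
  proof -
    have "(2 :: bit poly) = 0" using bit_poly_add_self[of 1] by simp
    thus ?thesis by (simp add: power2_sum)
  qed
  thus ?case by (simp add: Suc power_mult mult.commute[of 2])
qed simp

lemma cong_bit_poly: "[p = q] (mod r) \<longleftrightarrow> r dvd p + q" for p q r :: "bit poly"
proof -
  have "p - q = p + q" by (simp only: diff_eq_eq add.assoc bit_poly_add_self add_0_right)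
  thus ?thesis by (simp only: cong_iff_dvd_diff)
qed

lemma cong_monom:
  assumes "[i = j] (mod N)"
  shows "[monom 1 i = monom (1 :: bit) j] (mod (monom 1 N + 1))"
proof -
  have *: "[monom 1 (k + N * l) = monom (1 :: bit) k] (mod (monom 1 N + 1))" for k l
  proof -
    have "[monom (1 :: bit) N = 1] (mod (monom 1 N + 1))" by (simp add: cong_bit_poly)
    hence "[monom (1 :: bit) k * monom 1 N ^ l = monom 1 k * 1 ^ l] (mod (monom 1 N + 1))"
      by (intro cong_mult cong_pow cong_refl)
    thus ?thesis by (simp add: monom_power mult_monom)
  qed
  have "[monom 1 i = monom (1 :: bit) (i mod N)] (mod (monom 1 N + 1))"
    "[monom 1 j = monom (1 :: bit) (j mod N)] (mod (monom 1 N + 1))"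
    using *[of "i mod N" "i div N"] *[of "j mod N" "j div N"] by simp_all
  thus ?thesis using assms by (metis cong_def)
qed

lemma monom_power_nat: "monom (1 :: bit) a ^ k = monom 1 (a * k)"
  by (simp add: monom_power)

text \<open>As \<open>X Z = X^2 + X^N\<close>, powers of \<open>Z\<close> reduce to powers of
  \<open>1 + X\<close>, which are explicit when \<open>N\<close> is a power of 2.\<close>

lemma recip_cong:
  assumes "N > 0"
  shows "[monom 1 1 * recip N = (1 + monom 1 1) ^ 2] (mod (monom 1 N + 1))"
proof -
  have "(1 + monom (1 :: bit) 1) ^ 2 = 1 + monom 1 2"
    using freshmans_dream_bit_poly[of 1 "monom 1 1" 1] by (simp add: monom_power_nat)
  moreover have "monom 1 1 * recip N = monom 1 2 + monom 1 N"
    using assms by (simp add: recip_def ring_distribs mult_monom numeral_2_eq_2)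
  moreover have "monom (1 :: bit) 2 + monom 1 N + (1 + monom 1 2)
      = (monom 1 N + 1) + (monom 1 2 + monom 1 2)"
    by (simp add: ac_simps)
  ultimately show ?thesis by (simp add: cong_bit_poly bit_poly_add_self)
qed

lemma power2_halves:
  fixes N s :: nat
  assumes N: "N = 2 ^ s" and s: "s \<ge> 2"
  shows "N = 2 * (N div 2)" "N = 4 * (N div 4)" "N div 2 = 2 * (N div 4)" "N div 4 > 0" "N \<ge> 4"
proof -
  obtain t where "s = Suc (Suc t)" using s by (metis Suc_le_D numeral_2_eq_2 Suc_le_mono)
  thus "N = 2 * (N div 2)" "N = 4 * (N div 4)" "N div 2 = 2 * (N div 4)" "N div 4 > 0" "N \<ge> 4"
    using N by simp_all
qed

text \<open>\<open>N div 2\<close> is a power of 2, so the power is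
  \<open>X^(N/2) + X^(-N/2)\<close>, and the two exponents agree modulo \<open>N\<close>.\<close>

lemma recip_power_half:
  assumes N: "N = 2 ^ s" and s: "s \<ge> 2"
  shows "[recip N ^ (N div 2) = 0] (mod (monom 1 N + 1))"
proof -
  note half = power2_halves[OF assms]
  have h: "N div 2 = 2 ^ (s - 1)" using N s by (cases s) auto
  have "recip N ^ (N div 2) = monom 1 (N div 2) + monom 1 ((N - 1) * (N div 2))"
    unfolding recip_def h freshmans_dream_bit_poly monom_power_nat by simp
  moreover have "(N - 1) * (N div 2) = N div 2 + N * (N div 2 - 1)"
  proof -
    obtain k where "N div 2 = Suc k" using half by (metis gr0_conv_Suc mult_pos_pos zero_less_numeral)
    thus ?thesis using half(1) by (simp add: algebra_simps)
  qed
  hence "[monom 1 ((N - 1) * (N div 2)) = monom (1 :: bit) (N div 2)] (mod (monom 1 N + 1))"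
    by (intro cong_monom) (simp add: cong_def)
  ultimately show ?thesis
    by (simp add: cong_bit_poly add.commute)
qed

text \<open>Divide \<open>(1 + X)^N = 1 + X^N\<close> by \<open>(1 + X)^(2^j) = 1 + X^(2^j)\<close>:
  the quotient is a geometric sum. Applied with \<open>j = 0\<close> and
  \<open>j = 2\<close>.\<close>

lemma one_plus_X_power:
  fixes N s j :: nat
  assumes N: "N = 2 ^ s" and "j \<le> s"
  shows "(1 + monom (1 :: bit) 1) ^ (N - 2 ^ j) = (\<Sum>i<N div 2 ^ j. monom 1 (2 ^ j * i))"
proof -
  let ?y = "1 + monom (1 :: bit) 1"
  have yj: "?y ^ (2 ^ k) = 1 + monom 1 (2 ^ k)" for k
    by (simp only: freshmans_dream_bit_poly power_one monom_power_nat mult_1)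
  have *: "(1 + monom 1 (2 ^ j)) * (\<Sum>i<k. monom (1 :: bit) (2 ^ j * i)) = 1 + monom 1 (2 ^ j * k)" for k
  proof (induction k)
    case (Suc k)
    have "(1 + monom 1 (2 ^ j)) * (\<Sum>i<Suc k. monom (1 :: bit) (2 ^ j * i))
       = 1 + (monom 1 (2 ^ j * k) + monom 1 (2 ^ j * k)) + monom 1 (2 ^ j * Suc k)"
      by (simp add: Suc distrib_left) (simp add: distrib_right mult_monom ac_simps)
    thus ?case by (simp add: bit_poly_add_self)
  qed (simp add: monom_0 bit_poly_add_self flip: one_pCons)
  have "2 ^ j * (N div 2 ^ j) = N" "2 ^ j \<le> N"
    using assms by (simp_all add: N le_imp_power_dvd)
  hence "?y ^ (2 ^ j) * ?y ^ (N - 2 ^ j) = ?y ^ (2 ^ j) * (\<Sum>i<N div 2 ^ j. monom 1 (2 ^ j * i))"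
    by (simp add: power_add[symmetric] *[of "N div 2 ^ j"] yj[of s, folded N, simplified])
       (simp add: yj[of j, simplified] *[of "N div 2 ^ j"])
  moreover have "?y \<noteq> 0"
  proof
    assume "?y = 0"
    hence "coeff ?y 0 = coeff 0 0" by simp
    thus False by simp
  qed
  ultimately show ?thesis by simp
qed

section \<open>The \<open>F_2[X]\<close>-module structure in characteristic 2\<close>

context
  assumes char2: "CHAR('a :: finite_field) = 2"
begin

lemma two_eq_0: "(2 :: 'a) = 0"
  using char2 of_nat_CHAR[where 'a = 'a] by simp

lemma add_self: "x + x = (0 :: 'a)"
  using two_eq_0 by (simp flip: mult_2)

lemma add_eq_0: "x + y = (0 :: 'a) \<longleftrightarrow> x = y"
  by (metis add_self add_diff_cancel_right')

lemma frob_add: "frob k (u + v) = frob k u + frob k (v :: 'a)"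
  unfolding frob_def using freshmans_dream'[of "2^k" k u v] char2 by simp

lemma frob_sum: "frob k (sum f A) = (\<Sum>x\<in>A. frob k (f x :: 'a))"
  by (induction A rule: infinite_finite_induct) (simp_all add: frob_add)

lemma fixed_field_add: "u \<in> fixed_field N \<Longrightarrow> v \<in> fixed_field N \<Longrightarrow> u + v \<in> (fixed_field N :: 'a set)"
  by (simp add: fixed_field_def frob_add)

lemma scale2_add_left: "scale2 (a + b) x = scale2 a x + scale2 b (x :: 'a)"
  by (cases "a = 0"; cases "b = 0") (auto simp: scale2_def add_self)

lemma lin_add: "lin g (p + q) = lin g p + lin g q" for g :: "nat \<Rightarrow> 'a"
proof -
  let ?D = "max (degree p) (degree q)"
  have "degree (p + q) \<le> ?D" by (rule degree_add_le_max)
  thus ?thesis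
    by (simp only: lin_eq[of _ ?D] coeff_add scale2_add_left sum.distrib max.cobounded1 max.cobounded2)
qed

lemma lin_sum: "lin g (sum f A) = (\<Sum>x\<in>A. lin g (f x))" for g :: "nat \<Rightarrow> 'a"
  by (induction A rule: infinite_finite_induct) (simp_all add: lin_add)

lemma lin_smult: "lin g (smult a p) = scale2 a (lin g p)" for g :: "nat \<Rightarrow> 'a"
  by (cases "a = 0") simp_all

lemma lin_mult: "lin g (p * q) = lin (\<lambda>i. lin (\<lambda>j. g (i + j)) q) p" for g :: "nat \<Rightarrow> 'a"
proof (induction p arbitrary: g)
  case (pCons a p)
  show ?case
    by (simp add: lin_add lin_smult lin_pCons pCons.IH)
qed simp

lemma frob_lin: "frob k (lin g p) = lin (\<lambda>i. frob k (g i)) p" for g :: "nat \<Rightarrow> 'a"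
  by (rule additive_lin) (simp_all add: frob_add)

lemma frob_act: "frob k (act p u) = act p (frob k (u :: 'a))"
  by (simp add: act_def frob_lin frob_frob add.commute)

lemma act_mult: "act (p * q) u = act p (act q (u :: 'a))"
  by (simp add: act_def lin_mult frob_lin frob_frob)

lemma act_add: "act (p + q) u = act p u + act q (u :: 'a)"
  by (simp add: act_def lin_add)

lemma act_add_right: "act p (u + v) = act p u + act p (v :: 'a)"
  by (simp add: act_def frob_add lin_fun_add)

lemma act_zero_right [simp]: "act p 0 = (0 :: 'a)"
  by (simp add: act_def lin_def)

lemma act_0 [simp]: "act 0 u = (0 :: 'a)" and act_1 [simp]: "act 1 u = (u :: 'a)"
  by (simp_all add: act_def)

lemma act_sum: "act (sum f A) u = (\<Sum>x\<in>A. act (f x) (u :: 'a))"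
  by (simp add: act_def lin_sum)

lemma act_monom: "act (monom a k) u = scale2 a (frob k (u :: 'a))"
  by (simp add: act_def lin_monom)

lemma act_pCons: "act (pCons a p) u = scale2 a u + frob 1 (act p (u :: 'a))"
  by (simp add: act_def lin_pCons frob_lin frob_frob)

lemma act_fixed_field: "u \<in> fixed_field N \<Longrightarrow> act p u \<in> (fixed_field N :: 'a set)"
  by (simp add: fixed_field_def frob_act)

text \<open>By the freshman's dream, raising to the power \<open>2^t\<close> substitutes
  \<open>X^(2^t)\<close> for \<open>X\<close>.\<close>

lemma lin_power: "lin g (p ^ (2 ^ t)) = lin (\<lambda>i. g (i * 2 ^ t)) p" for g :: "nat \<Rightarrow> 'a"
proof (induction p arbitrary: g)
  case (pCons a p)
  have "pCons a p = [:a:] + monom 1 1 * p"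
    by (simp add: monom_altdef)
  hence "pCons a p ^ (2 ^ t) = [:a:] ^ (2 ^ t) + monom 1 (2 ^ t) * p ^ (2 ^ t)"
    by (simp only: freshmans_dream_bit_poly power_mult_distrib monom_power) simp
  moreover have "[:a:] ^ (2 ^ t) = [:a:]"
    by (cases a) (simp_all add: one_pCons[symmetric])
  ultimately show ?case
    by (simp add: lin_add lin_mult lin_monom lin_pCons pCons.IH algebra_simps)
qed (simp add: power_0_left)

lemma act_power: "act (p ^ (2 ^ t)) u = lin (\<lambda>i. frob (i * 2 ^ t) u) p" for u :: 'a
  by (simp add: act_def lin_power)


lemma lin_01: "(\<And>i. c i \<in> {0, 1}) \<Longrightarrow> lin c p \<in> {0, 1 :: 'a}"
proof (induction p arbitrary: c)
  case (pCons a p)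
  have "lin (\<lambda>i. c (Suc i)) p \<in> {0, 1}" by (rule pCons.IH) (rule pCons.prems)
  thus ?case using pCons.prems[of 0] add_self[of 1]
    by (auto simp: lin_pCons scale2_def)
qed simp

section \<open>Traces and the trace form\<close>

lemma trace2_add: "trace2 N (u + v) = trace2 N u + trace2 N (v :: 'a)"
  by (simp add: trace2_frob frob_add sum.distrib)

lemma trace2_sum: "trace2 N (sum f A) = (\<Sum>x\<in>A. trace2 N (f x :: 'a))"
  by (induction A rule: infinite_finite_induct) (simp_all add: trace2_add, simp_all add: trace2_frob)

lemma trace2_frob1:
  assumes "u \<in> fixed_field N"
  shows "trace2 N (frob 1 u) = trace2 N (u :: 'a)" and "frob 1 (trace2 N u) = trace2 N (u :: 'a)"
proof -
  have "(\<Sum>i<N. frob (Suc i) u) = (\<Sum>i<N. frob i u)"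
    by (rule sum_lessThan_Suc_period) (use assms in \<open>simp add: fixed_field_def\<close>)
  thus "trace2 N (frob 1 u) = trace2 N u" "frob 1 (trace2 N u) = trace2 N u"
    by (simp_all add: trace2_frob frob_frob frob_sum)
qed

lemma trace2_frob_k:
  assumes "u \<in> fixed_field N"
  shows "trace2 N (frob k u) = trace2 N (u :: 'a)"
proof (induction k)
  case (Suc k)
  have "frob (Suc k) u = frob 1 (frob k u)" by (simp add: frob_frob)
  thus ?case using trace2_frob1[OF fixed_field_frob[OF assms]] Suc by simp
qed simp

lemma trace2_01:
  assumes "u \<in> fixed_field N"
  shows "trace2 N (u :: 'a) \<in> {0, 1}"
proof -
  have "trace2 N u * (trace2 N u - 1) = 0"
    using trace2_frob1(2)[OF assms] by (simp add: frob_1 algebra_simps power2_eq_square)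
  thus ?thesis by auto
qed

lemma trace_form_add_left: "trace_form N (u + v) (w :: 'a) = trace_form N u w + trace_form N v w"
  by (simp add: trace_form_def ring_distribs trace2_add)

lemma trace_form_add_right: "trace_form N w (u + v :: 'a) = trace_form N w u + trace_form N w v"
  by (simp add: trace_form_def ring_distribs trace2_add)

lemma trace_form_0 [simp]: "trace_form N 0 v = (0 :: 'a)" "trace_form N v 0 = (0 :: 'a)"
  by (simp_all add: trace_form_def trace2_frob)

lemma trace_form_sum_right: "trace_form N (w :: 'a) (sum f A) = (\<Sum>x\<in>A. trace_form N w (f x))"
  by (simp add: trace_form_def sum_distrib_left trace2_sum)

lemma trace_form_frob:
  assumes "u \<in> fixed_field N" "v \<in> fixed_field N"
  shows "trace_form N (frob k u) (frob k v :: 'a) = trace_form N u v"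
  using trace2_frob_k[OF fixed_field_times[OF assms]]
  by (simp add: trace_form_def frob_mult)

lemma trace_form_01:
  assumes "u \<in> fixed_field N" "v \<in> fixed_field N"
  shows "trace_form N u (v :: 'a) \<in> {0, 1}"
  unfolding trace_form_def by (rule trace2_01) (rule fixed_field_times[OF assms])

lemma trace_form_act: "trace_form N v (act p u :: 'a) = lin (\<lambda>i. trace_form N v (frob i u)) p"
  unfolding act_def by (rule additive_lin) (simp_all add: trace_form_add_right)

lemma trace_form_self:
  assumes "u \<in> fixed_field N"
  shows "trace_form N u u = trace2 N (u :: 'a)"
  using trace2_frob1(1)[OF assms] by (simp add: trace_form_def frob_1 power2_eq_square)

section \<open>Correlation polynomials\<close>

lemma lin_corr:
  assumes "u \<in> fixed_field N" "v \<in> fixed_field N"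
  shows "lin g (corr N u (v :: 'a)) = (\<Sum>k<N. trace_form N u (frob k v) * g k)"
proof -
  have "scale2 (if trace_form N u (frob k v) = 0 then 0 else 1) y = trace_form N u (frob k v) * y"
    for k y using trace_form_01[OF assms(1) fixed_field_frob[OF assms(2)]] by auto
  thus ?thesis by (simp add: corr_def lin_sum lin_monom)
qed

lemma act_corr:
  fixes u v :: 'a
  assumes "u \<in> fixed_field N" "v \<in> fixed_field N"
  shows "act (corr N u v) (w :: 'a) = (\<Sum>k<N. trace_form N u (frob k v) * frob k w)"
  unfolding act_def by (rule lin_corr[OF assms])

lemma frob_trace_form:
  assumes "u \<in> fixed_field N" "v \<in> fixed_field N"
  shows "frob k (trace_form N u v) = trace_form N u (v :: 'a)"
  using trace_form_01[OF assms] by auto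

lemma act_corr_frob1:
  fixes u v :: 'a
  assumes "u \<in> fixed_field N" "v \<in> fixed_field N" "w \<in> fixed_field N"
  shows "act (corr N (frob 1 u) v) (w :: 'a) = frob 1 (act (corr N u v) w)"
proof -
  have "frob 1 (act (corr N u v) w) = (\<Sum>k<N. trace_form N u (frob k v) * frob (Suc k) w)"
    using assms
    by (simp add: act_corr frob_sum frob_mult frob_trace_form fixed_field_frob frob_frob)
  also have "\<dots> = (\<Sum>k<N. trace_form N (frob 1 u) (frob (Suc k) v) * frob (Suc k) w)"
    using trace_form_frob[OF assms(1) fixed_field_frob[OF assms(2)], of 1] by (simp add: frob_frob)
  also have "\<dots> = (\<Sum>k<N. trace_form N (frob 1 u) (frob k v) * frob k w)"
    by (rule sum_lessThan_Suc_period) (use assms in \<open>simp add: fixed_field_def\<close>)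
  finally show ?thesis using assms by (simp add: act_corr fixed_field_frob)
qed

lemma act_corr_add_left:
  fixes u u' v :: 'a
  assumes "u \<in> fixed_field N" "u' \<in> fixed_field N" "v \<in> fixed_field N"
  shows "act (corr N (u + u') v) (w :: 'a) = act (corr N u v) w + act (corr N u' v) w"
  using assms
  by (simp add: act_corr fixed_field_add trace_form_add_left ring_distribs sum.distrib)

lemma act_corr_add_right:
  fixes u v v' :: 'a
  assumes "u \<in> fixed_field N" "v' \<in> fixed_field N" "v \<in> fixed_field N"
  shows "act (corr N u (v + v')) (w :: 'a) = act (corr N u v) w + act (corr N u v') w"
  using assms
  by (simp add: act_corr fixed_field_add trace_form_add_right frob_add ring_distribs sum.distrib)

text \<open>\<open>F_2[X]\<close>-linearity in the first argument, by Horner's scheme from the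
  Frobenius case. Stated through the action because the polynomials agree only modulo
  \<open>X^N + 1\<close>.\<close>

lemma act_corr_act:
  fixes u v :: 'a
  assumes "u \<in> fixed_field N" "v \<in> fixed_field N" "w \<in> fixed_field N"
  shows "act (corr N (act p u) v) (w :: 'a) = act p (act (corr N u v) w)"
proof (induction p)
  case 0
  show ?case using assms by (simp add: act_corr)
next
  case (pCons a p)
  have z: "act (corr N 0 v) w = 0" using assms by (simp add: act_corr)
  have "act (corr N (act (pCons a p) u) v) w
      = act (corr N (scale2 a u) v) w + act (corr N (frob 1 (act p u)) v) w"
    unfolding act_pCons using assms
    by (subst act_corr_add_left) (auto simp: act_fixed_field fixed_field_frob scale2_def)
  also have "act (corr N (frob 1 (act p u)) v) w = frob 1 (act (corr N (act p u) v) w)"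
    by (rule act_corr_frob1) (use assms act_fixed_field in auto)
  finally show ?case using pCons.IH z by (simp add: act_pCons scale2_def)
qed

text \<open>\<open>act p\<close> is a linearized polynomial of degree at most
  \<open>2^(n-1)\<close>; unless zero, it cannot vanish at all \<open>2^n\<close> field
  elements.\<close>

lemma act_faithful:
  assumes "card (UNIV :: 'a set) = 2 ^ n" "degree p < n" "\<And>u :: 'a. act p u = 0"
  shows "p = 0"
proof -
  define P where "P = (\<Sum>i\<le>degree p. monom (scale2 (coeff p i) (1 :: 'a)) (2 ^ i))"
  have "poly P u = act p u" for u
    by (simp add: P_def poly_sum poly_monom act_def lin_def frob_def scale2_def if_distrib if_distribR cong: if_cong)
  hence roots: "{u. poly P u = 0} = UNIV" using assms(3) by simp
  have "degree P \<le> 2 ^ degree p" unfolding P_def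
    by (rule degree_sum_le) (auto intro: order.trans[OF degree_monom_le])
  also have "\<dots> < (2 :: nat) ^ n" using assms(2) by simp
  finally have "P = 0"
    using card_poly_roots_bound[of P] roots assms(1) by fastforce
  show "p = 0"
  proof (rule poly_eqI)
    fix k
    show "coeff p k = coeff 0 k"
    proof (cases "k \<le> degree p")
      case True
      have "0 = coeff P (2 ^ k)" using \<open>P = 0\<close> by simp
      also have "\<dots> = scale2 (coeff p k) 1"
        using True by (simp add: P_def coeff_sum)
      finally show ?thesis by (simp add: scale2_def split: if_splits)
    qed (simp add: coeff_eq_0)
  qed
qed

lemma act_rel_trace: "act (rel_trace m r) u = (\<Sum>j<r. frob (m * j) (u :: 'a))"
  by (simp add: rel_trace_def act_sum act_monom)

lemma act_rel_trace_fixed: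
  assumes "u \<in> fixed_field (m * r)"
  shows "act (rel_trace m r) u \<in> (fixed_field m :: 'a set)"
proof -
  have "frob m (act (rel_trace m r) u) = (\<Sum>j<r. frob (m * Suc j) u)"
    by (simp add: act_rel_trace frob_sum frob_frob)
  also have "\<dots> = (\<Sum>j<r. frob (m * j) u)"
    by (rule sum_lessThan_Suc_period) (use assms in \<open>simp add: fixed_field_def\<close>)
  finally show ?thesis by (simp add: fixed_field_def act_rel_trace)
qed

lemma trace2_rel_trace: "trace2 (m * r) u = trace2 m (act (rel_trace m r) (u :: 'a))"
proof -
  have "trace2 (m * r) u = (\<Sum>j<r. \<Sum>i\<in>{j * m..<j * m + m}. frob i u)"
    unfolding trace2_frob sum.nat_group by (simp add: mult.commute)
  also have "\<dots> = (\<Sum>j<r. \<Sum>i<m. frob (i + m * j) u)"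
  proof (rule sum.cong[OF refl])
    fix j
    show "(\<Sum>i\<in>{j * m..<j * m + m}. frob i u) = (\<Sum>i<m. frob (i + m * j) u)"
      using sum.shift_bounds_nat_ivl[of "\<lambda>i. frob i u" 0 "j * m" m]
      by (simp add: mult.commute add.commute atLeast0LessThan)
  qed
  also have "\<dots> = trace2 m (act (rel_trace m r) u)"
    unfolding trace2_frob act_rel_trace frob_sum frob_frob by (rule sum.swap)
  finally show ?thesis .
qed

lemma fixed_field_UNIV:
  assumes "card (UNIV :: 'a set) = 2 ^ n"
  shows "fixed_field n = (UNIV :: 'a set)"
  using finite_field_power_card_eq_same[where 'a = 'a] assms by (auto simp: fixed_field_def frob_def)

text \<open>The relative trace maps the whole field into \<open>fixed_field m\<close>, so
  \<open>p * rel_trace m r\<close> kills everything, and its degree is below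
  \<open>m * r\<close>.\<close>

lemma act_faithful_fixed_field:
  assumes "card (UNIV :: 'a set) = 2 ^ (m * r)" "r > 0" "degree p < m"
    and "\<And>u :: 'a. u \<in> fixed_field m \<Longrightarrow> act p u = 0"
  shows "p = 0"
proof -
  let ?Q = "rel_trace m r"
  have "act (p * ?Q) u = 0" for u :: 'a
    unfolding act_mult using fixed_field_UNIV[OF assms(1)] assms(4) act_rel_trace_fixed by blast
  moreover have "degree ?Q \<le> m * (r - 1)" unfolding rel_trace_def
    by (rule degree_sum_le) (auto intro!: order.trans[OF degree_monom_le])
  hence "degree p + degree ?Q < m + m * (r - 1)" using assms(3) by linarith
  hence "degree (p * ?Q) < m * r" using degree_mult_le[of p ?Q] assms(2)
    by (cases r) auto
  ultimately have "p * ?Q = 0"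
    using act_faithful[OF assms(1)] by blast
  moreover have "coeff ?Q 0 = (\<Sum>j<r. if j = 0 then 1 else 0)"
    unfolding rel_trace_def coeff_sum using assms(3) by (intro sum.cong) auto
  hence "?Q \<noteq> 0" using assms(2) by auto
  ultimately show ?thesis by simp
qed

section \<open>Self-dual normal elements in odd degree\<close>

lemma adjointD:
  fixes v w :: 'a
  assumes "adjoint TYPE('a) N p q" "v \<in> fixed_field N" "w \<in> fixed_field N"
  shows "trace_form N (act p v) w = trace_form N v (act q w)"
  using assms by (auto simp: adjoint_def)

lemma adjoint_add:
  assumes "adjoint TYPE('a) N p p'" "adjoint TYPE('a) N q q'"
  shows "adjoint TYPE('a) N (p + q) (p' + q')"
  using assms by (simp add: adjoint_def act_add trace_form_add_left trace_form_add_right)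

lemma adjoint_1: "adjoint TYPE('a) N 1 1"
  by (simp add: adjoint_def)

lemma adjoint_mult:
  assumes "adjoint TYPE('a) N p p'" "adjoint TYPE('a) N q q'"
  shows "adjoint TYPE('a) N (p * q) (p' * q')"
  unfolding adjoint_def
proof (intro ballI)
  fix v w :: 'a assume vw: "v \<in> fixed_field N" "w \<in> fixed_field N"
  have "trace_form N (act (p * q) v) w = trace_form N v (act q' (act p' w))"
    using adjointD[OF assms(1)] adjointD[OF assms(2)] vw by (simp add: act_mult act_fixed_field)
  thus "trace_form N (act (p * q) v) w = trace_form N v (act (p' * q') w)"
    by (simp add: act_mult[symmetric] mult.commute)
qed

lemma adjoint_power:
  assumes "adjoint TYPE('a) N p q"
  shows "adjoint TYPE('a) N (p ^ k) (q ^ k)"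
  by (induction k) (simp_all add: adjoint_1 adjoint_mult assms)

lemma trace_form_shift:
  fixes u v :: 'a
  assumes "u \<in> fixed_field N" "v \<in> fixed_field N" "N dvd i + j"
  shows "trace_form N u (frob i v) = trace_form N (frob j u) v"
proof -
  have "trace_form N u (frob i v) = trace_form N (frob j u) (frob (j + i) v)"
    using trace_form_frob[OF assms(1) fixed_field_frob[OF assms(2)], of j i] by (simp add: frob_frob)
  also have "frob (j + i) v = v"
    using assms(3) frob_mult_period[OF assms(2)] by (auto simp: add.commute elim!: dvdE)
  finally show ?thesis .
qed

lemma adjoint_monom:
  assumes "N dvd i + j"
  shows "adjoint TYPE('a) N (monom 1 i) (monom 1 j)"
  unfolding adjoint_def act_monom scale2_1
  using trace_form_shift[of _ N _ j i] assms by (metis add.commute)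

text \<open>Taking adjoints sends \<open>X^k\<close> to \<open>X^-k\<close>, and the coefficients of
  an autocorrelation are even in \<open>k\<close>.\<close>

lemma self_adjoint_corr:
  assumes "u \<in> fixed_field N"
  shows "adjoint TYPE('a) N (corr N u u) (corr N u (u :: 'a))"
  unfolding adjoint_def
proof (intro ballI)
  fix v w :: 'a assume vw: "v \<in> fixed_field N" "w \<in> fixed_field N"
  let ?s = "\<lambda>k. trace_form N u (frob k u)"
  define f where "f k = ?s k * trace_form N v (frob k w)" for k
  have ts: "trace_form N x (\<Sum>k<N. ?s k * y k) = (\<Sum>k<N. ?s k * trace_form N x (y k))" for x y
  proof -
    have "trace_form N x (?s k * y k) = ?s k * trace_form N x (y k)" for k
      using trace_form_01[OF assms fixed_field_frob[OF assms], of k] by auto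
    thus ?thesis by (simp add: trace_form_sum_right)
  qed
  have "trace_form N v (act (corr N u u) w) = (\<Sum>k<N. f k)"
    by (simp add: act_corr assms ts f_def)
  \<comment> \<open>Passing to the indices \<open>1..N\<close> makes the reversal \<open>k\<close>
    to \<open>N - k\<close> a plain reindexing.\<close>
  also have "\<dots> = (\<Sum>k<N. f (Suc k))"
    by (rule sum_lessThan_Suc_period[symmetric])
       (use assms vw in \<open>simp add: f_def fixed_field_def\<close>)
  also have "\<dots> = (\<Sum>k<N. f (Suc (N - Suc k)))"
    by (rule sum.nat_diff_reindex[symmetric])
  also have "\<dots> = (\<Sum>k<N. ?s k * trace_form N w (frob k v))"
  proof (rule sum.cong)
    fix k assume "k \<in> {..<N}"
    hence "Suc (N - Suc k) = N - k" "N dvd (N - k) + k" by auto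
    thus "f (Suc (N - Suc k)) = ?s k * trace_form N w (frob k v)"
      using trace_form_shift[OF vw, of "N - k" k] trace_form_shift[OF assms assms, of "N - k" k]
      by (simp add: f_def trace_form_commute)
  qed simp
  also have "\<dots> = trace_form N w (act (corr N u u) v)"
    by (simp add: act_corr assms ts)
  finally show "trace_form N (act (corr N u u) v) w = trace_form N v (act (corr N u u) w)"
    by (simp add: trace_form_commute)
qed

text \<open>The norm \<open>p p*\<close> is \<open>p^2\<close> for self-adjoint \<open>p\<close>.
  Coefficients are compared one by one, so the polynomials themselves are equal.\<close>

lemma corr_act_act:
  fixes u v :: 'a
  assumes "adjoint TYPE('a) N p p" "u \<in> fixed_field N" "v \<in> fixed_field N"
  shows "corr N (act p u) (act p v) = corr N (act (p * p) u) v"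
  unfolding corr_def act_mult frob_act
  using assms by (simp add: adjointD act_fixed_field fixed_field_frob)

text \<open>The power substitutes \<open>X^(2^t)\<close>, which is \<open>X\<close> modulo
  \<open>X^N + 1\<close>. For odd \<open>N\<close> some \<open>t > 0\<close> qualifies; this is how
  reducedness enters.\<close>

lemma act_power_cong_1:
  fixes u :: 'a
  assumes "[2 ^ t = 1] (mod N)" "u \<in> fixed_field N"
  shows "act (p ^ (2 ^ t)) u = act p u"
proof -
  have "frob (i * 2 ^ t) u = frob i u" for i
    using frob_cong[OF assms(2) cong_scalar_left[OF assms(1), of i]] by simp
  thus ?thesis unfolding act_power by (simp add: act_def)
qed

lemma of_nat_odd: "odd k \<Longrightarrow> of_nat k = (1 :: 'a)"
  using two_eq_0 by (auto elim!: oddE)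

text \<open>If all autocorrelations on the image of \<open>f\<close> vanished, polarization would
  let a shift pass between the arguments. Then every shift of \<open>u\<close> pairs to 1 with a
  suitable \<open>v\<close>, so \<open>Tr(u)\<close> is nonzero, against
  \<open>Tr(u) = Tr(u^2) = 0\<close>.\<close>

lemma exists_nonisotropic:
  fixes u :: 'a
  assumes "odd m" and f: "adjoint TYPE('a) m f f"
    and idem: "\<And>x :: 'a. x \<in> fixed_field m \<Longrightarrow> act f (act f x) = act f x"
    and u: "u \<in> fixed_field m" "u \<noteq> 0" "act f u = u"
  shows "\<exists>w \<in> fixed_field m :: 'a set. act f w = w \<and> (\<exists>k. trace_form m w (frob k w) \<noteq> 0)"
proof (rule ccontr)
  assume "\<not> ?thesis"
  hence iso: "trace_form m w (frob k w) = 0" if "w \<in> fixed_field m" "act f w = w" for w :: 'a and k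
    using that by auto
  have "inverse u \<in> fixed_field m"
    using u(1) by (simp add: fixed_field_def frob_def power_inverse)
  \<comment> \<open>Projecting \<open>u^-1\<close> to the image of \<open>f\<close> keeps its
    pairing with \<open>u\<close>, namely \<open>Tr(1) = m = 1\<close>.\<close>
  define v where "v = act f (inverse u)"
  have v: "v \<in> fixed_field m" "act f v = v"
    unfolding v_def using act_fixed_field[OF \<open>inverse u \<in> _\<close>] idem[OF \<open>inverse u \<in> _\<close>] by auto
  have "trace_form m u v = trace_form m (act f u) (inverse u)"
    unfolding v_def using adjointD[OF f u(1) \<open>inverse u \<in> _\<close>] by simp
  also have "\<dots> = 1"
    using u of_nat_odd[OF \<open>odd m\<close>] by (simp add: trace_form_def trace2_def)
  finally have uv: "trace_form m u v = 1" .
  have sym: "trace_form m x (frob k y) = trace_form m y (frob k x)"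
    if "x \<in> fixed_field m" "act f x = x" "y \<in> fixed_field m" "act f y = y" for x y :: 'a and k
    using iso[of "x + y" k] iso[of x k] iso[of y k] that
    by (simp add: fixed_field_add act_add_right frob_add trace_form_add_left trace_form_add_right add_eq_0)
  have one: "trace_form m v (frob i u) = 1" for i
  proof -
    \<comment> \<open>\<open>j\<close> is half of \<open>i\<close> modulo the odd \<open>m\<close>:
      one of two shifts by \<open>j\<close> is moved to \<open>v\<close> by \<open>sym\<close>, and
      then both cancel.\<close>
    define j where "j = i * ((m + 1) div 2)"
    have "2 * j = i + m * i" using \<open>odd m\<close> by (auto simp: j_def algebra_simps elim!: oddE)
    hence "[2 * j = i] (mod m)" by (simp add: cong_def)
    hence "trace_form m v (frob i u) = trace_form m v (frob j (frob j u))"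
      using frob_cong[OF u(1)] by (simp add: frob_frob mult_2)
    also have "\<dots> = trace_form m (frob j u) (frob j v)"
      by (rule sym) (use u v fixed_field_frob in \<open>auto simp flip: frob_act\<close>)
    also have "\<dots> = trace_form m u v"
      by (rule trace_form_frob[OF u(1) v(1)])
    finally show ?thesis using uv by simp
  qed
  have "trace_form m v (trace2 m u) = of_nat m"
    by (simp add: trace2_frob trace_form_sum_right one)
  hence "trace2 m u \<noteq> 0" using of_nat_odd[OF \<open>odd m\<close>] by auto
  thus False using iso[OF u(1) u(3), of 0] trace_form_self[OF u(1)] by simp
qed

text \<open>If \<open>2^t = 1\<close> modulo \<open>m\<close>, then \<open>D^(2^t)\<close> acts as
  \<open>D\<close>, so \<open>E = D^(2^t - 1)\<close> acts idempotently and generates the same ideal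
  as \<open>D\<close>. It is an autocorrelation: \<open>E = g^2 D\<close> in its action, with
  \<open>g\<close> self-adjoint because \<open>D\<close> is.\<close>

lemma exists_idempotent_corr:
  fixes w :: 'a
  assumes "odd m" "w \<in> fixed_field m"
  defines "D \<equiv> corr m w w"
  shows "\<exists>g. \<forall>x :: 'a. x \<in> fixed_field m \<longrightarrow>
    (let E = corr m (act g w) (act g w) in
      act E (act E x) = act E x \<and> act (D * E) x = act D x \<and> (\<exists>r. act E x = act (r * D) x))"
proof -
  define t where "t = totient m"
  have "m > 0" using \<open>odd m\<close> by (auto intro: Nat.gr0I)
  hence t: "t > 0" "[2 ^ t = 1] (mod m)"
    using euler_theorem[of 2 m] \<open>odd m\<close> by (simp_all add: t_def)
  define g where "g = D ^ (2 ^ (t - 1) - 1)"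
  define q :: nat where "q = 2 ^ t - 2"
  have two: "2 ^ t = 2 * (2 :: nat) ^ (t - 1)" using t(1) by (cases t) auto
  have ge: "(2 :: nat) ^ (t - 1) \<ge> 1" by simp
  have gg: "g * g = D ^ q" unfolding g_def q_def two
    by (simp add: mult_2 numeral_2_eq_2 flip: power_add)
  have Dt: "act (D ^ (q + 2)) x = act D x" if "x \<in> fixed_field m" for x :: 'a
  proof -
    have "q + 2 = 2 ^ t" using two ge unfolding q_def by linarith
    thus ?thesis using act_power_cong_1[OF t(2) that, of D] by (simp only:)
  qed
  have sa: "adjoint TYPE('a) m g g"
    unfolding g_def D_def by (intro adjoint_power self_adjoint_corr assms)
  have E: "act (corr m (act g w) (act g w)) x = act (D ^ (q + 1)) x" if "x \<in> fixed_field m" for x :: 'a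
    using act_corr_act[OF assms(2) assms(2) that, of "g * g"] that
    by (simp add: corr_act_act[OF sa assms(2) assms(2)] gg flip: D_def act_mult)
       (simp add: mult.commute)
  show ?thesis
  proof (rule exI[of _ g], intro allI impI)
    fix x :: 'a assume x: "x \<in> fixed_field m"
    have "act (D ^ (q + 1)) (act (D ^ (q + 1)) x) = act (D ^ q) (act (D ^ (q + 2)) x)"
      unfolding act_mult[symmetric] power_add[symmetric] by (rule arg_cong[of _ _ "\<lambda>p. act p x"]) simp
    also have "\<dots> = act (D ^ (q + 1)) x"
      unfolding Dt[OF x] act_mult[symmetric] by (simp add: mult.commute)
    finally have 1: "act (D ^ (q + 1)) (act (D ^ (q + 1)) x) = act (D ^ (q + 1)) x" .
    have 2: "act D (act (D ^ (q + 1)) x) = act D x"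
      using Dt[OF x] by (simp flip: act_mult)
    have 3: "act (D ^ (q + 1)) x = act (D ^ q * D) x" by (simp add: mult.commute)
    show "let E = corr m (act g w) (act g w) in act E (act E x) = act E x \<and>
        act (D * E) x = act D x \<and> (\<exists>r. act E x = act (r * D) x)"
      unfolding Let_def act_mult[of D] using 1 2 3 E x act_fixed_field[OF x] by metis
  qed
qed

text \<open>Take an element whose autocorrelation \<open>e\<close> acts idempotently with largest
  image. If \<open>e\<close> is not the identity, the complementary summand contains an element with
  nonzero idempotent autocorrelation, and adding it enlarges the image.\<close>

lemma exists_self_dual_normal:
  assumes "card (UNIV :: 'a set) = 2 ^ (m * r)" "r > 0" "odd m"
  shows "\<exists>\<gamma> :: 'a. \<gamma> \<in> fixed_field m \<and>
    (\<forall>k. trace_form m \<gamma> (frob k \<gamma>) = (if m dvd k then 1 else 0))"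
proof -
  have "m > 0" using \<open>odd m\<close> by (auto intro: Nat.gr0I)
  let ?K = "fixed_field m :: 'a set"
  let ?C = "\<lambda>\<gamma> :: 'a. corr m \<gamma> \<gamma>"
  define S where "S = {\<gamma> \<in> ?K. \<forall>x \<in> ?K. act (?C \<gamma>) (act (?C \<gamma>) x) = act (?C \<gamma>) x}"
  define \<mu> where "\<mu> \<gamma> = card (act (?C \<gamma>) ` ?K)" for \<gamma>
  have "0 \<in> S" by (simp add: S_def act_corr)
  hence "Max (\<mu> ` S) \<in> \<mu> ` S" by (intro Max_in) auto
  then obtain \<gamma> where "\<gamma> \<in> S" "Max (\<mu> ` S) = \<mu> \<gamma>" by auto
  hence max: "\<mu> \<delta> \<le> \<mu> \<gamma>" if "\<delta> \<in> S" for \<delta>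
    using Max_ge[of "\<mu> ` S" "\<mu> \<delta>"] that by auto
  define e where "e = ?C \<gamma>"
  have \<gamma>: "\<gamma> \<in> ?K" and e_idem: "\<And>x. x \<in> ?K \<Longrightarrow> act e (act e x) = act e x"
    using \<open>\<gamma> \<in> S\<close> by (auto simp: S_def e_def)
  have e_sa: "adjoint TYPE('a) m e e" unfolding e_def by (rule self_adjoint_corr[OF \<gamma>])
  have "act e x = x" if x: "x \<in> ?K" for x
  proof (rule ccontr)
    assume "act e x \<noteq> x"
    define f where "f = 1 + e"
    define u where "u = act f x"
    have f: "act f y = y + act e y" for y :: 'a by (simp add: f_def act_add)
    have f_idem: "act f (act f y) = act f y" if "y \<in> ?K" for y
      using e_idem[OF that] by (simp add: f act_add_right add_self)
    have "u \<in> ?K" "u \<noteq> 0" "act f u = u"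
      using x f_idem[OF x] \<open>act e x \<noteq> x\<close> act_fixed_field[OF x]
      by (auto simp: u_def) (simp add: f add_eq_0)
    moreover have "adjoint TYPE('a) m f f"
      unfolding f_def by (intro adjoint_add adjoint_1 e_sa)
    ultimately obtain w k where w: "w \<in> ?K" "act f w = w" and nz: "trace_form m w (frob k w) \<noteq> 0"
      using exists_nonisotropic[OF \<open>odd m\<close> _ f_idem] by blast
    have ew: "act e w = 0" using w(2) by (simp add: f)
    define D where "D = ?C w"
    obtain g where g: "\<And>x. x \<in> ?K \<Longrightarrow>
      (let E = ?C (act g w) in act E (act E x) = act E x \<and> act (D * E) x = act D x \<and>
        (\<exists>r. act E x = act (r * D) x))"
      using exists_idempotent_corr[OF \<open>odd m\<close> w(1)] unfolding D_def by auto
    define w' where "w' = act g w"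
    define E where "E = ?C w'"
    have E_idem: "\<And>x. x \<in> ?K \<Longrightarrow> act E (act E x) = act E x"
      and DE: "\<And>x. x \<in> ?K \<Longrightarrow> act (D * E) x = act D x"
      and rD: "\<And>x. x \<in> ?K \<Longrightarrow> \<exists>r. act E x = act (r * D) x"
      using g by (auto simp: Let_def E_def w'_def)
    have w': "w' \<in> ?K" unfolding w'_def by (rule act_fixed_field[OF w(1)])
    \<comment> \<open>Moving \<open>e\<close> into the first argument gives
      \<open>corr m (act e w) w\<close>, which is 0.\<close>
    have eD: "act (e * D) y = 0" if "y \<in> ?K" for y
      using act_corr_act[OF w(1) w(1) that, of e] w(1) that
      by (simp add: ew D_def act_mult act_corr)
    have eE: "act e (act E y) = 0" if y: "y \<in> ?K" for y
    proof -
      obtain r where "act E y = act (r * D) y" using rD[OF y] by blast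
      hence "act e (act E y) = act r (act (e * D) y)"
        by (simp flip: act_mult) (simp add: mult_ac)
      thus ?thesis using eD[OF y] by simp
    qed
    \<comment> \<open>\<open>D\<close> has a nonzero coefficient at \<open>k mod m\<close>, so it
      acts nontrivially; hence so does \<open>E\<close>, because \<open>D * E\<close> acts as
      \<open>D\<close>.\<close>
    obtain x0 where x0: "x0 \<in> ?K" "act E x0 \<noteq> 0"
    proof -
      have "frob k w = frob (k mod m) w" by (rule frob_mod[OF w(1), symmetric])
      hence "coeff D (k mod m) \<noteq> 0"
        using nz \<open>m > 0\<close> by (simp add: D_def coeff_corr)
      hence "D \<noteq> 0" by auto
      moreover have "degree D < m" unfolding D_def by (rule degree_corr[OF \<open>m > 0\<close>])
      ultimately obtain y :: 'a where y: "y \<in> ?K" "act D y \<noteq> 0"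
        using act_faithful_fixed_field[OF assms(1,2)] by blast
      hence "act E y \<noteq> 0" using DE[OF y(1)] by (auto simp: act_mult)
      thus ?thesis using that y by blast
    qed
    \<comment> \<open>Passing from \<open>\<gamma>\<close> to \<open>act e \<gamma>\<close> keeps
      the action of the autocorrelation and gives orthogonality to the conjugates of
      \<open>w'\<close>, so the cross terms vanish.\<close>
    define \<delta> where "\<delta> = act e \<gamma> + w'"
    have e\<gamma>: "act e \<gamma> \<in> ?K" by (rule act_fixed_field[OF \<gamma>])
    have C\<delta>: "act (?C \<delta>) y = act e y + act E y" if y: "y \<in> ?K" for y
    proof -
      have "act e w' = 0"
        unfolding w'_def act_mult[symmetric] mult.commute[of e g] by (simp add: act_mult ew)
      have "act (?C (act e \<gamma>)) y = act e y"
        using corr_act_act[OF e_sa \<gamma> \<gamma>] act_corr_act[OF \<gamma> \<gamma> y, of "e * e"] e_idem[OF y]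
          e_idem[OF act_fixed_field[OF y]]
        by (simp add: act_mult flip: e_def)
      moreover have "act (corr m (act e \<gamma>) w') y = 0" "act (corr m w' (act e \<gamma>)) y = 0"
      proof -
        have "trace_form m (act e \<gamma>) (frob k w') = 0" for k
          using adjointD[OF e_sa \<gamma> fixed_field_frob[OF w']] \<open>act e w' = 0\<close>
          by (simp flip: frob_act)
        thus "act (corr m (act e \<gamma>) w') y = 0" using e\<gamma> w' by (simp add: act_corr)
        have "trace_form m w' (frob k (act e \<gamma>)) = 0" for k
          using adjointD[OF e_sa w' fixed_field_frob[OF \<gamma>], of k] \<open>act e w' = 0\<close>
          by (simp add: frob_act)
        thus "act (corr m w' (act e \<gamma>)) y = 0" using e\<gamma> w' by (simp add: act_corr)
      qed
      ultimately show ?thesis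
        unfolding \<delta>_def E_def using e\<gamma> w'
        by (simp add: act_corr_add_left act_corr_add_right fixed_field_add)
    qed
    have Ee: "act E (act e y) = 0" if "y \<in> ?K" for y
      using eE[OF that] by (metis act_mult mult.commute)
    have "\<delta> \<in> S" unfolding S_def
      using e\<gamma> w' C\<delta> e_idem E_idem eE Ee
      by (auto simp: \<delta>_def[symmetric] fixed_field_add act_add_right act_fixed_field)
         (simp add: \<delta>_def fixed_field_add)
    \<comment> \<open>The new autocorrelation fixes \<open>act E x0\<close>, while \<open>e\<close>,
      the identity on its own image, kills it.\<close>
    moreover have "\<mu> \<gamma> < \<mu> \<delta>" unfolding \<mu>_def
    proof (rule psubset_card_mono)
      have "act e y = act (?C \<delta>) (act e y)" if "y \<in> ?K" for y
        using that by (simp add: C\<delta> act_fixed_field e_idem Ee)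
      hence "act (?C \<gamma>) ` ?K \<subseteq> act (?C \<delta>) ` ?K"
        using act_fixed_field by (fastforce simp flip: e_def)
      moreover have "act E x0 = act (?C \<delta>) (act E x0)"
        using x0 by (simp add: C\<delta> act_fixed_field E_idem eE)
      hence "act E x0 \<in> act (?C \<delta>) ` ?K" using act_fixed_field[OF x0(1)] by blast
      moreover have "act E x0 \<notin> act (?C \<gamma>) ` ?K"
        using x0 eE[OF x0(1)] e_idem by (auto simp flip: e_def)
      ultimately show "act (?C \<gamma>) ` ?K \<subset> act (?C \<delta>) ` ?K" by blast
    qed simp
    ultimately show False using max[of \<delta>] by simp
  qed
  moreover have "degree (e + 1) < m"
    unfolding e_def using degree_corr[OF \<open>m > 0\<close>] \<open>m > 0\<close> by (intro degree_add_less) auto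
  ultimately have "e + 1 = 0"
    using act_faithful_fixed_field[OF assms(1,2)] by (simp add: act_add add_self)
  have "trace_form m \<gamma> (frob k \<gamma>) = (if m dvd k then 1 else 0)" for k
  proof -
    have "coeff e (k mod m) + coeff 1 (k mod m) = 0"
      using \<open>e + 1 = 0\<close> by (metis coeff_add coeff_0)
    hence "trace_form m \<gamma> (frob (k mod m) \<gamma>) = 0 \<longleftrightarrow> k mod m \<noteq> 0"
      using \<open>m > 0\<close> by (auto simp: e_def coeff_corr split: if_splits)
    thus ?thesis
      using trace_form_01[OF \<gamma> fixed_field_frob[OF \<gamma>], of k] frob_mod[OF \<gamma>, of k] by auto
  qed
  thus ?thesis using \<gamma> by blast
qed

section \<open>Weight 3 in degree a power of 2\<close>

lemma palindromic_add:
  assumes "palindromic N (c :: nat \<Rightarrow> 'a)" "palindromic N d"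
  shows "palindromic N (\<lambda>i. c i + d i)"
  using assms unfolding palindromic_def by metis

lemma recip_coeff_add:
  "recip_coeff N (\<lambda>i. c i + d i) m k = recip_coeff N c m k + recip_coeff N d m k" for c :: "nat \<Rightarrow> 'a"
  by (simp add: recip_coeff_def lin_fun_add)

lemma palindromic_autocorrelation:
  assumes "\<beta> \<in> fixed_field N"
  shows "palindromic N (\<lambda>i. trace_form N \<beta> (frob i \<beta>) :: 'a)"
  unfolding palindromic_def
  using frob_cong[OF assms] trace_form_shift[OF assms assms] trace_form_commute by metis

context
  fixes N s :: nat
  assumes N: "N = 2 ^ s" and s: "s \<ge> 2"
begin

lemmas half = power2_halves[OF N s]

lemma quarter:
  obtains q where "N = 4 * q" "N div 2 = 2 * q" "N div 4 = q" "q > 0"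
  using half(2,3,4) that[of "N div 4"] by blast

text \<open>Periodicity of \<open>c\<close> makes \<open>X^i\<close> and \<open>X^(i + N)\<close>
  pair equally, so the pairing is defined modulo \<open>X^N + 1\<close>.\<close>

lemma lin_cong:
  assumes "palindromic N (c :: nat \<Rightarrow> 'a)" "[p = q] (mod (monom 1 N + 1))"
  shows "lin c p = lin c q"
proof -
  obtain r where r: "p + q = r * (monom 1 N + 1)"
    using assms(2) unfolding cong_bit_poly by (metis dvdE mult.commute)
  have "[i + N = i] (mod N)" for i by (simp add: cong_def)
  hence "c (i + N) = c i" for i
    using assms(1) unfolding palindromic_def by blast
  hence "lin c (p + q) = lin (\<lambda>i. c i + c i) r"
    by (simp only: r lin_mult lin_add lin_monom lin_1 scale2_1 add_0_right)
  also have "\<dots> = 0" by (simp add: add_self) (simp add: lin_def)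
  finally show ?thesis by (simp add: lin_add add_eq_0)
qed

section \<open>The coefficients of \<open>Z^m c\<close> for symmetric \<open>c\<close>\<close>

lemma recip_coeff_0 [simp]: "recip_coeff N c 0 k = c k"
  by (simp add: recip_coeff_def lin_monom)

lemma recip_coeff_period:
  assumes "palindromic N (c :: nat \<Rightarrow> 'a)"
  shows "recip_coeff N c m (k + N) = recip_coeff N c m k"
  unfolding recip_coeff_def
  by (intro lin_cong assms cong_mult cong_refl cong_monom) (simp add: cong_def)

text \<open>\<open>Z\<close> adds the two neighbouring coefficients; the index \<open>Suc k\<close>
  avoids a negative neighbour.\<close>

lemma recip_coeff_Suc:
  assumes "palindromic N (c :: nat \<Rightarrow> 'a)"
  shows "recip_coeff N c (Suc m) (Suc k) = recip_coeff N c m (k + 2) + recip_coeff N c m k"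
proof -
  have "recip N * monom 1 (Suc k) = monom 1 (k + 2) + monom 1 (k + N)"
    using half(5) by (simp add: recip_def distrib_right mult_monom add.commute)
  hence "recip N ^ Suc m * monom 1 (Suc k) = recip N ^ m * monom 1 (k + 2) + recip N ^ m * monom 1 (k + N)"
    by (simp only: power_Suc2 mult.assoc distrib_left)
  hence "recip_coeff N c (Suc m) (Suc k) = recip_coeff N c m (k + 2) + recip_coeff N c m (k + N)"
    by (simp add: recip_coeff_def lin_add)
  thus ?thesis using recip_coeff_period[OF assms] by simp
qed

lemma recip_coeff_sym:
  assumes "palindromic N (c :: nat \<Rightarrow> 'a)" "N dvd i + j"
  shows "recip_coeff N c m i = recip_coeff N c m j"
  using assms(2)
proof (induction m arbitrary: i j)
  case 0
  thus ?case using assms(1) by (simp add: palindromic_def)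
next
  case (Suc m)
  have *: "recip_coeff N c (Suc m) k = recip_coeff N c m (k + N + 1) + recip_coeff N c m (k + N - 1)" for k
    using recip_coeff_period[OF assms(1), of "Suc m" k] half(5)
      recip_coeff_Suc[OF assms(1), of m "k + N - 1"] by simp
  have "N dvd (i + N + 1) + (j + N - 1)" "N dvd (i + N - 1) + (j + N + 1)"
  proof -
    have "(i + N + 1) + (j + N - 1) = (i + j) + 2 * N" "(i + N - 1) + (j + N + 1) = (i + j) + 2 * N"
      using half(5) by simp_all
    thus "N dvd (i + N + 1) + (j + N - 1)" "N dvd (i + N - 1) + (j + N + 1)"
      using Suc.prems by (simp_all only: dvd_add dvd_triv_right)
  qed
  thus ?case unfolding *[of i] *[of j]
    by (metis Suc.IH add.commute)
qed

lemma recip_coeff_Suc_0: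
  assumes "palindromic N (c :: nat \<Rightarrow> 'a)"
  shows "recip_coeff N c (Suc m) 0 = 0"
proof -
  have "recip_coeff N c (Suc m) 0 = recip_coeff N c m (N + 1) + recip_coeff N c m (N - 1)"
    using recip_coeff_period[OF assms, of "Suc m" 0] half(5)
      recip_coeff_Suc[OF assms, of m "N - 1"] by simp
  also have "recip_coeff N c m (N + 1) = recip_coeff N c m (N - 1)"
    by (rule recip_coeff_sym[OF assms]) (use half(5) in simp)
  finally show ?thesis by (simp add: add_self)
qed

lemma recip_coeff_vanish:
  assumes "palindromic N (c :: nat \<Rightarrow> 'a)" "m \<ge> N div 2"
  shows "recip_coeff N c m k = 0"
proof -
  have "recip N ^ m = recip N ^ (N div 2) * recip N ^ (m - N div 2)"
    using assms(2) by (simp flip: power_add)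
  hence "[recip N ^ m * monom 1 k = 0 * recip N ^ (m - N div 2) * monom 1 k] (mod (monom 1 N + 1))"
    by (simp only:) (intro cong_mult cong_refl recip_power_half[OF N s])
  hence "recip_coeff N c m k = lin c 0"
    unfolding recip_coeff_def by (intro lin_cong[OF assms(1)]) simp
  thus ?thesis by simp
qed

text \<open>Once \<open>Z\<close> kills \<open>Z^m c\<close>, coefficients two apart agree, so one
  unknown value remains, at the odd indices.\<close>

lemma recip_coeff_parity:
  assumes "palindromic N (c :: nat \<Rightarrow> 'a)" "\<And>k. recip_coeff N c (Suc m) k = 0" "recip_coeff N c m 0 = 0"
  shows "recip_coeff N c m k = (if odd k then recip_coeff N c m 1 else 0)"
proof (induction k rule: nat_induct2)
  case (step k)
  thus ?case using recip_coeff_Suc[OF assms(1), of m k] assms(2) by (simp add: add_eq_0)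
qed (use assms(3) in auto)

lemma recip_coeff_shift:
  assumes "palindromic N (c :: nat \<Rightarrow> 'a)"
  shows "lin c (recip N ^ m * monom 1 m * p) = lin c ((1 + monom 1 1) ^ (2 * m) * p)"
proof (rule lin_cong[OF assms])
  have "[(monom 1 1 * recip N) ^ m * p = ((1 + monom 1 1) ^ 2) ^ m * p] (mod (monom 1 N + 1))"
    by (intro cong_mult cong_pow cong_refl recip_cong) (use half(5) in simp)
  thus "[recip N ^ m * monom 1 m * p = (1 + monom 1 1) ^ (2 * m) * p] (mod (monom 1 N + 1))"
    by (simp add: power_mult_distrib monom_power_nat ac_simps flip: power_mult)
qed

lemma recip_coeff_top:
  assumes "palindromic N (c :: nat \<Rightarrow> 'a)"
  shows "recip_coeff N c (N div 2 - 1) k = (if odd k then \<Sum>i<N. c i else 0)"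
proof -
  obtain q where q: "N = 4 * q" "N div 2 = 2 * q" "N div 4 = q" "q > 0" using quarter by blast
  let ?m = "N div 2 - 1"
  have m: "Suc ?m = N div 2" "?m = Suc (N div 2 - 2)" using q by simp_all
  have par: "recip_coeff N c ?m k = (if odd k then recip_coeff N c ?m 1 else 0)" for k
    by (rule recip_coeff_parity[OF assms])
       (use m recip_coeff_vanish[OF assms] recip_coeff_Suc_0[OF assms] in auto)
  \<comment> \<open>Two consecutive coefficients, one of odd index, supply the factor completing
    \<open>(1 + X)^(N - 2)\<close> to \<open>(1 + X)^(N - 1)\<close>, the sum of all
    \<open>X^i\<close> with \<open>i < N\<close>.\<close>
  have "recip_coeff N c ?m ?m + recip_coeff N c ?m (Suc ?m)
      = lin c (recip N ^ ?m * monom 1 ?m * (1 + monom 1 1))"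
    by (simp add: recip_coeff_def distrib_left lin_add mult_monom mult.assoc)
  also have "\<dots> = lin c ((1 + monom 1 1) ^ (2 * ?m) * (1 + monom 1 1))"
    by (rule recip_coeff_shift[OF assms])
  also have "(1 + monom (1 :: bit) 1) ^ (2 * ?m) * (1 + monom 1 1) = (1 + monom 1 1) ^ (N - 2 ^ 0)"
  proof -
    have "Suc (2 * ?m) = N - 2 ^ 0" using q by simp
    thus ?thesis by (metis power_Suc2)
  qed
  also have "lin c \<dots> = (\<Sum>i<N. c i)"
    by (subst one_plus_X_power[OF N]) (simp_all add: lin_sum lin_monom)
  finally have "recip_coeff N c ?m ?m + recip_coeff N c ?m (Suc ?m) = (\<Sum>i<N. c i)" .
  moreover have "odd ?m" using q by simp
  ultimately have "recip_coeff N c ?m 1 = (\<Sum>i<N. c i)"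
    using par[of ?m] par[of "Suc ?m"] by auto
  thus ?thesis using par[of k] by simp
qed

text \<open>By parity one value remains. As \<open>(1 + X)^(N - 4)\<close> is the sum of the
  \<open>X^(4 i)\<close>, that value is the sum of \<open>c\<close> over indices 1 modulo 4.\<close>

lemma recip_coeff_base:
  assumes "palindromic N (c :: nat \<Rightarrow> 'a)" "c 0 = 0" "(\<Sum>i<N. c i) = 0" "(\<Sum>i<N div 4. c (4 * i + 1)) = 0"
  shows "recip_coeff N c (N div 2 - 2) k = 0"
proof -
  obtain q where q: "N = 4 * q" "N div 2 = 2 * q" "N div 4 = q" "q > 0" using quarter by blast
  let ?m = "N div 2 - 2"
  have m: "Suc ?m = N div 2 - 1" using q by simp
  have par: "recip_coeff N c ?m k = (if odd k then recip_coeff N c ?m 1 else 0)" for k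
  proof (rule recip_coeff_parity[OF assms(1)])
    show "recip_coeff N c (Suc ?m) k = 0" for k
      unfolding m recip_coeff_top[OF assms(1)] using assms(3) by simp
    \<comment> \<open>For \<open>N = 4\<close> the exponent is 0 and this is \<open>c 0 = 0\<close>;
      otherwise the neighbours of index 0 cancel.\<close>
    show "recip_coeff N c ?m 0 = 0"
      using assms(2) recip_coeff_Suc_0[OF assms(1)] by (cases ?m) auto
  qed
  have "recip_coeff N c ?m (Suc ?m) = lin c (recip N ^ ?m * monom 1 ?m * monom 1 1)"
    by (simp add: recip_coeff_def mult_monom mult.assoc)
  also have "\<dots> = lin c ((1 + monom 1 1) ^ (2 * ?m) * monom 1 1)"
    by (rule recip_coeff_shift[OF assms(1)])
  also have "2 * ?m = N - 2 ^ 2" using q by simp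
  also have "lin c ((1 + monom 1 1) ^ (N - 2 ^ 2) * monom 1 1) = (\<Sum>i<N div 4. c (4 * i + 1))"
    by (subst one_plus_X_power[OF N]) (simp_all add: s sum_distrib_right lin_sum mult_monom lin_monom)
  finally have "recip_coeff N c ?m (Suc ?m) = 0" using assms(4) by simp
  moreover have "odd (Suc ?m)" using q by simp
  ultimately have "recip_coeff N c ?m 1 = 0" using par[of "Suc ?m"] by metis
  thus ?thesis using par[of k] by simp
qed

section \<open>Sums shared by \<open>1 + X + X^-1\<close> and the autocorrelations of trace 1
  elements\<close>

lemma palindromic_weight3_pattern: "palindromic N (weight3_pattern N :: nat \<Rightarrow> 'a)"
  unfolding palindromic_def
proof (intro conjI allI impI)
  fix i j
  assume ij: "N dvd i + j"
  have "i mod N \<in> {0, 1, N - 1} \<Longrightarrow> j mod N \<in> {0, 1, N - 1}" if "N dvd i + j" for i j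
  proof -
    have "(i mod N + j mod N) mod N = 0" using that by (simp add: mod_add_eq dvd_eq_mod_eq_0)
    moreover have "i mod N < N" "j mod N < N" using half(5) by auto
    ultimately have sum: "i mod N + j mod N = 0 \<or> i mod N + j mod N = N"
      using mod_less[of "i mod N + j mod N" N] le_mod_geq[of N "i mod N + j mod N"]
      by (cases "i mod N + j mod N < N") simp_all
    have "x \<in> {0, 1, N - 1} \<Longrightarrow> y \<in> {0, 1, N - 1}" if "x + y = 0 \<or> x + y = N" "y < N" for x y
      using that by auto
    from this[OF sum \<open>j mod N < N\<close>]
    show "i mod N \<in> {0, 1, N - 1} \<Longrightarrow> j mod N \<in> {0, 1, N - 1}" .
  qed
  thus "weight3_pattern N i = (weight3_pattern N j :: 'a)" using ij unfolding weight3_pattern_def by (metis add.commute)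
qed (simp add: weight3_pattern_def cong_def)

lemma sum_weight3_pattern: "(\<Sum>i<N. weight3_pattern N i) = (1 :: 'a)"
proof -
  have "(\<Sum>i<N. weight3_pattern N i :: 'a) = (\<Sum>i\<in>{0, 1, N - 1}. 1)"
    by (rule sum.mono_neutral_cong_right) (use half(5) in \<open>auto simp: weight3_pattern_def\<close>)
  also have "\<dots> = of_nat 3"
    using half(5) by simp
  also have "\<dots> = 1" by (rule of_nat_odd) simp
  finally show ?thesis .
qed

lemma sum_weight3_pattern_4: "(\<Sum>i<N div 4. weight3_pattern N (4 * i + 1)) = (1 :: 'a)"
proof -
  have "weight3_pattern N (4 * i + 1) = (if i = 0 then 1 else 0 :: 'a)" if "i < N div 4" for i
  proof -
    \<comment> \<open>\<open>N - 1\<close> is 3 modulo 4, so only \<open>i = 0\<close> meets the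
      pattern.\<close>
    have "4 * i + 1 < N" "4 * i + 1 \<noteq> N - 1" using that half(2) by presburger+
    thus ?thesis by (auto simp: weight3_pattern_def)
  qed
  thus ?thesis using half(4) by simp
qed

text \<open>The first sum is \<open>Tr(\<beta> Tr(\<beta>))\<close>. The second is
  \<open>Tr(\<beta> v^2)\<close>, with \<open>v\<close> the relative trace of \<open>\<beta>\<close>
  to degree 4, and descends to the degree 4 trace of \<open>v^3\<close>.\<close>

lemma sum_autocorrelation:
  assumes "\<beta> \<in> fixed_field N" "trace2 N \<beta> = (1 :: 'a)"
  shows "(\<Sum>i<N. trace_form N \<beta> (frob i \<beta>)) = 1"
    and "(\<Sum>i<N div 4. trace_form N \<beta> (frob (4 * i + 1) \<beta>)) = 1"
proof -
  show "(\<Sum>i<N. trace_form N \<beta> (frob i \<beta>)) = 1"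
    using assms by (simp add: trace2_frob[of N \<beta>, symmetric] flip: trace_form_sum_right)
       (simp add: trace_form_def)
  define v where "v = act (rel_trace 4 (N div 4)) \<beta>"
  have v: "v \<in> fixed_field 4"
    unfolding v_def by (rule act_rel_trace_fixed) (use assms half(2) in simp)
  hence v16: "v ^ 16 = v" by (simp add: fixed_field_def frob_def)
  have tv: "trace2 4 v = 1"
    using trace2_rel_trace[of 4 "N div 4" \<beta>] assms(2) half(2) by (simp add: v_def)
  \<comment> \<open>\<open>u\<close> is the trace of \<open>v\<close> to degree 2. Then
    \<open>Tr(v) = 1\<close> reads \<open>u + u^2 = 1\<close>, so \<open>u^3 = 1\<close>, and
    \<open>u * u^2\<close> expands to the trace of \<open>v^3\<close>.\<close>
  define u where "u = v + v ^ 4"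
  have u2: "u ^ 2 = v ^ 2 + v ^ 8"
    using frob_add[of 1 v "v ^ 4"] by (simp add: u_def frob_def flip: power_mult)
  have "u + u ^ 2 = 1"
    using tv unfolding u2 by (simp add: u_def trace2_def eval_nat_numeral ac_simps)
  hence "u ^ 2 = 1 + u" by (metis add.assoc add.commute add_self add_0_right)
  hence "u * u ^ 2 = 1" using \<open>u + u ^ 2 = 1\<close> by (simp add: distrib_left flip: power2_eq_square)
  have "(\<Sum>i<N div 4. trace_form N \<beta> (frob (4 * i + 1) \<beta>)) = trace_form N \<beta> (frob 1 v)"
    by (simp add: v_def act_rel_trace frob_sum frob_frob trace_form_sum_right)
  also have "\<dots> = trace2 4 (act (rel_trace 4 (N div 4)) (\<beta> * frob 1 v))"
    using trace2_rel_trace[of 4 "N div 4" "\<beta> * frob 1 v"] half(2) by (simp add: trace_form_def)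
  also have "act (rel_trace 4 (N div 4)) (\<beta> * frob 1 v) = v * frob 1 v"
    using frob_mult_period[OF fixed_field_frob[OF v]]
    by (simp add: v_def act_rel_trace frob_mult flip: sum_distrib_right)
  also have "trace2 4 (v * frob 1 v) = v ^ 3 + v ^ 6 + v ^ 12 + v ^ 24"
    by (simp add: trace2_def frob_def eval_nat_numeral lessThan_Suc ac_simps)
  also have "v ^ 24 = v ^ 16 * v ^ 8" by (simp flip: power_add)
  also have "v ^ 16 * v ^ 8 = v ^ 9" unfolding v16 by (simp flip: power_Suc)
  also have "v ^ 3 + v ^ 6 + v ^ 12 + v ^ 9 = u * u ^ 2"
    unfolding u2 by (simp add: u_def distrib_left distrib_right ac_simps flip: power_add power_Suc power_Suc2)
  finally show "(\<Sum>i<N div 4. trace_form N \<beta> (frob (4 * i + 1) \<beta>)) = 1"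
    using \<open>u * u ^ 2 = 1\<close> by simp
qed

section \<open>Correcting an autocorrelation by norms\<close>

lemma adjoint_recip: "adjoint TYPE('a) N (recip N) (recip N)"
proof -
  have "adjoint TYPE('a) N (monom 1 1 + monom 1 (N - 1)) (monom 1 (N - 1) + monom 1 1)"
    by (intro adjoint_add adjoint_monom) (use half(5) in simp_all)
  thus ?thesis by (simp add: recip_def add.commute)
qed

text \<open>Multiplying \<open>\<beta>\<close> by \<open>1 + (1 + X) Z\<^sup>a\<close> with \<open>Z = X + X\<^sup>-\<^sup>1\<close> multiplies its
  autocorrelation by the norm \<open>1 + Z ^ (a + 1) + Z ^ (2 * a + 1)\<close> of that unit.\<close>

lemma autocorrelation_modify:
  fixes \<beta> :: 'a and a m k :: nat
  assumes \<beta>: "\<beta> \<in> fixed_field N"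
  defines "\<beta>' \<equiv> act (1 + (1 + monom 1 1) * recip N ^ a) \<beta>"
  shows "recip_coeff N (\<lambda>i. trace_form N \<beta>' (frob i \<beta>')) m k =
    recip_coeff N (\<lambda>i. trace_form N \<beta> (frob i \<beta>)) m k
    + recip_coeff N (\<lambda>i. trace_form N \<beta> (frob i \<beta>)) (m + a + 1) k
    + recip_coeff N (\<lambda>i. trace_form N \<beta> (frob i \<beta>)) (m + 2 * a + 1) k"
proof -
  define c where "c = (\<lambda>i. trace_form N \<beta> (frob i \<beta>))"
  have c: "palindromic N c" unfolding c_def by (rule palindromic_autocorrelation[OF \<beta>])
  let ?X = "monom (1 :: bit) 1" and ?Y = "monom (1 :: bit) (N - 1)" and ?Z = "recip N"
  \<comment> \<open>\<open>?g'\<close> is \<open>?g\<close> with \<open>X^-1\<close> in place of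
    \<open>X\<close>; \<open>Z\<close> is its own adjoint.\<close>
  let ?g = "1 + (1 + ?X) * ?Z ^ a" and ?g' = "1 + (1 + ?Y) * ?Z ^ a"
  have "adjoint TYPE('a) N ?g ?g'"
    by (intro adjoint_add adjoint_1 adjoint_mult adjoint_power adjoint_recip adjoint_monom)
       (use half(5) in simp)
  hence *: "lin (\<lambda>i. trace_form N \<beta>' (frob i \<beta>')) p = lin c (?g' * ?g * p)" for p
  proof -
    have "lin (\<lambda>i. trace_form N \<beta>' (frob i \<beta>')) p = trace_form N (act ?g \<beta>) (act p (act ?g \<beta>))"
      by (simp add: trace_form_act \<beta>'_def)
    also have "\<dots> = trace_form N \<beta> (act ?g' (act p (act ?g \<beta>)))"
      by (rule adjointD[OF \<open>adjoint _ _ _ _\<close> \<beta>]) (intro act_fixed_field \<beta>)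
    also have "\<dots> = trace_form N \<beta> (act (?g' * ?g * p) \<beta>)"
      unfolding act_mult[symmetric] by (simp add: ac_simps)
    finally show ?thesis by (simp add: trace_form_act c_def)
  qed
  have "(1 + q * W) * (1 + p * W) = 1 + (p + q) * W + (p * q) * (W * W)" for p q W :: "bit poly"
    by (simp add: algebra_simps)
  note this[of "1 + ?Y" "?Z ^ a" "1 + ?X"]
  moreover have "(1 + ?X) + (1 + ?Y) = (1 + 1) + ?Z"
    by (simp only: recip_def ac_simps)
  hence "(1 + ?X) + (1 + ?Y) = ?Z" by (simp only: bit_poly_add_self add_0_left)
  moreover have "(1 + ?X) * (1 + ?Y) = 1 + ?X * ?Y + ?Z"
    by (simp only: recip_def distrib_left distrib_right ac_simps mult_1_left mult_1_right)
  moreover have "?X * ?Y = monom 1 N" using half(5) by (simp add: mult_monom)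
  moreover have "?Z ^ a * ?Z ^ a = ?Z ^ (2 * a)" by (simp only: mult_2 power_add)
  ultimately have gg: "?g' * ?g = 1 + ?Z * ?Z ^ a + (1 + monom 1 N + ?Z) * ?Z ^ (2 * a)"
    by (simp only:)
  \<comment> \<open>\<open>(1 + X) (1 + X^-1)\<close> is represented by \<open>1 + X^N + Z\<close>,
    which reduces to \<open>Z\<close>.\<close>
  have "[1 + monom 1 N + ?Z = 0 + ?Z] (mod (monom 1 N + 1))"
    by (intro cong_add cong_refl) (simp add: cong_bit_poly add.commute)
  hence "[?g' * ?g * (?Z ^ m * monom 1 k) = (1 + ?Z * ?Z ^ a + (0 + ?Z) * ?Z ^ (2 * a)) * (?Z ^ m * monom 1 k)] (mod (monom 1 N + 1))"
    unfolding gg by (intro cong_mult[OF _ cong_refl] cong_add[OF cong_refl])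
  also have "(1 + ?Z * ?Z ^ a + (0 + ?Z) * ?Z ^ (2 * a)) * (?Z ^ m * monom 1 k)
      = ?Z ^ m * monom 1 k + ?Z ^ (m + a + 1) * monom 1 k + ?Z ^ (m + 2 * a + 1) * monom 1 k"
    by (simp only: distrib_left distrib_right power_add mult_2 power_one_right mult_1_left add_0_left ac_simps)
  finally show ?thesis
    unfolding recip_coeff_def * c_def[symmetric] by (simp add: lin_cong[OF c] lin_add)
qed

text \<open>Downward induction on \<open>m\<close> for \<open>Z^m d = 0\<close>, with
  \<open>d\<close> the difference from the target, starting at \<open>N div 2 - 2\<close>; at
  \<open>m = 0\<close> it says \<open>d = 0\<close>.\<close>

lemma exists_weight3_autocorrelation:
  assumes card: "card (UNIV :: 'a set) = 2 ^ (N * r)" "r > 0"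
  shows "\<exists>\<beta> \<in> fixed_field N. trace2 N \<beta> = (1 :: 'a) \<and> (\<forall>i. trace_form N \<beta> (frob i \<beta>) = weight3_pattern N i)"
proof -
  define d where "d \<beta> i = trace_form N \<beta> (frob i \<beta>) + weight3_pattern N i" for \<beta> :: 'a and i
  have d: "palindromic N (d \<beta>)" if "\<beta> \<in> fixed_field N" for \<beta>
    unfolding d_def by (intro palindromic_add palindromic_autocorrelation palindromic_weight3_pattern that)
  have d0: "d \<beta> 0 = 0" if "\<beta> \<in> fixed_field N" "trace2 N \<beta> = 1" for \<beta>
    using trace_form_self[OF that(1)] that(2) by (simp add: d_def weight3_pattern_def add_self)
  have "\<exists>\<beta> \<in> fixed_field N. trace2 N \<beta> = 1 \<and> (\<forall>k. recip_coeff N (d \<beta>) 0 k = 0)"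
  proof (rule inc_induct[of 0 "N div 2 - 2"])
    \<comment> \<open>The absolute trace is not identically zero by faithfulness, and it factors
      through the relative trace to degree \<open>N\<close>; this yields an element of trace
      1.\<close>
    have "rel_trace 1 (N * r) \<noteq> 0"
    proof
      assume "rel_trace 1 (N * r) = 0"
      hence "coeff (rel_trace 1 (N * r)) 0 = coeff 0 0" by simp
      thus False using half(5) \<open>r > 0\<close> by (simp add: rel_trace_def coeff_sum if_distrib cong: if_cong)
    qed
    moreover have "degree (rel_trace 1 (N * r)) < N * r"
      unfolding rel_trace_def using half(5) \<open>r > 0\<close>
      by (intro degree_sum_less) (auto intro: le_less_trans[OF degree_monom_le])
    ultimately obtain x :: 'a where "act (rel_trace 1 (N * r)) x \<noteq> 0"
      using act_faithful[OF card(1)] by blast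
    hence "trace2 N (act (rel_trace N r) x) \<noteq> 0"
      unfolding trace2_rel_trace[symmetric] by (simp add: act_rel_trace trace2_frob)
    moreover have \<beta>: "act (rel_trace N r) x \<in> fixed_field N"
      by (rule act_rel_trace_fixed) (use fixed_field_UNIV[OF card(1)] in simp)
    ultimately have tr: "trace2 N (act (rel_trace N r) x) = 1"
      using trace2_01 by blast
    have "recip_coeff N (d (act (rel_trace N r) x)) (N div 2 - 2) k = 0" for k
      by (rule recip_coeff_base)
         (use d[OF \<beta>] d0[OF \<beta> tr] sum_autocorrelation[OF \<beta> tr] sum_weight3_pattern sum_weight3_pattern_4 in
           \<open>simp_all add: d_def sum.distrib add_self\<close>)
    thus "\<exists>\<beta> \<in> fixed_field N. trace2 N \<beta> = (1 :: 'a) \<and> (\<forall>k. recip_coeff N (d \<beta>) (N div 2 - 2) k = 0)"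
      using \<beta> tr by blast
  next
    fix m assume m: "m < N div 2 - 2"
    assume "\<exists>\<beta> \<in> fixed_field N. trace2 N \<beta> = (1 :: 'a) \<and> (\<forall>k. recip_coeff N (d \<beta>) (Suc m) k = 0)"
    then obtain \<beta> where \<beta>: "\<beta> \<in> fixed_field N" and tr: "trace2 N \<beta> = 1"
      and Suc: "\<And>k. recip_coeff N (d \<beta>) (Suc m) k = 0" by blast
    have "recip_coeff N (d \<beta>) m 0 = 0"
      using d0[OF \<beta> tr] recip_coeff_Suc_0[OF d[OF \<beta>]] by (cases m) auto
    note par = recip_coeff_parity[OF d[OF \<beta>] Suc this]
    have "d \<beta> i \<in> {0, 1}" for i
      using trace_form_01[OF \<beta> fixed_field_frob[OF \<beta>], of i] add_self[of 1]
      by (auto simp: d_def weight3_pattern_def)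
    hence "recip_coeff N (d \<beta>) m 1 \<in> {0, 1}"
      unfolding recip_coeff_def by (rule lin_01)
    then consider "recip_coeff N (d \<beta>) m 1 = 0" | "recip_coeff N (d \<beta>) m 1 = 1" by blast
    thus "\<exists>\<beta> \<in> fixed_field N. trace2 N \<beta> = (1 :: 'a) \<and> (\<forall>k. recip_coeff N (d \<beta>) m k = 0)"
    proof cases
      case 1
      hence "recip_coeff N (d \<beta>) m k = 0" for k using par[of k] by simp
      thus ?thesis using \<beta> tr by blast
    next
      case 2
      hence odd: "recip_coeff N (d \<beta>) m k = (if odd k then 1 else 0)" for k
        using par[of k] by simp
      \<comment> \<open>Chosen so that the first correction term is \<open>Z^(N/2 - 1)\<close> times
        the autocorrelation, which is 1 exactly at odd indices; the second has exponent at least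
        \<open>N/2\<close> and vanishes.\<close>
      define a where "a = N div 2 - 2 - m"
      have a: "m + a + 1 = N div 2 - 1" "m + 2 * a + 1 \<ge> N div 2"
        using m by (simp_all add: a_def)
      define \<beta>' where "\<beta>' = act (1 + (1 + monom 1 1) * recip N ^ a) \<beta>"
      have \<beta>': "\<beta>' \<in> fixed_field N" unfolding \<beta>'_def by (rule act_fixed_field[OF \<beta>])
      define w where "w = act (recip N ^ a) \<beta>"
      have w: "w \<in> fixed_field N" unfolding w_def by (rule act_fixed_field[OF \<beta>])
      have "\<beta>' = \<beta> + (w + frob 1 w)"
        by (simp add: \<beta>'_def w_def act_add act_mult act_monom)
      hence "trace2 N \<beta>' = 1"
        using trace2_frob1(1)[OF w] tr by (simp add: trace2_add add_self)
      moreover have "recip_coeff N (d \<beta>') m k = 0" for k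
        using autocorrelation_modify[OF \<beta>, of a m k, folded \<beta>'_def] odd[of k]
          recip_coeff_top[OF palindromic_autocorrelation[OF \<beta>], of k]
          recip_coeff_vanish[OF palindromic_autocorrelation[OF \<beta>] a(2), of k]
          sum_autocorrelation(1)[OF \<beta> tr]
        unfolding d_def recip_coeff_add a(1)
        by (simp add: ac_simps add_self split: if_splits)
      ultimately show ?thesis using \<beta>' by blast
    qed
  qed simp
  thus ?thesis by (auto simp: d_def add_eq_0)
qed

end

section \<open>Normality and the product construction\<close>

text \<open>A trivial annihilator makes the subset sums of the conjugates distinct. There are
  \<open>2^n\<close> of them, so they fill the field, which gives spanning.\<close>

lemma normal_elementI:
  fixes \<alpha> :: 'a
  assumes card: "card (UNIV :: 'a set) = 2 ^ n" and "n > 0"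
    and inj: "\<And>p. degree p < n \<Longrightarrow> act p \<alpha> = 0 \<Longrightarrow> p = 0"
  shows "normal_element n \<alpha>"
proof -
  interpret V: vector_space "scale2 :: bit \<Rightarrow> 'a \<Rightarrow> 'a" by (rule vector_space_scale2[OF card])
  let ?f = "\<lambda>i. frob i \<alpha>"
  let ?P = "\<lambda>c. \<Sum>i<n. monom (c i :: bit) i"
  have "{\<alpha> ^ (2 ^ i) | i. i < n} = ?f ` {..<n}" by (auto simp: frob_def)
  have coeff_P: "coeff (?P c) i = c i" if "i < n" for c i
    using that by (simp add: coeff_sum)
  have P0: "c i = 0" if "act (?P c) \<alpha> = 0" "i < n" for c i
  proof -
    have "degree (?P c) < n" using \<open>n > 0\<close>
      by (intro degree_sum_less) (auto intro: le_less_trans[OF degree_monom_le])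
    hence "?P c = 0" using inj that(1) by blast
    thus ?thesis using coeff_P[OF that(2), of c] by simp
  qed
  have act_P: "act (?P c) \<alpha> = (\<Sum>i<n. scale2 (c i) (?f i))" for c
    by (simp add: act_sum act_monom)
  have Pow_inj: "I = J" if "I \<subseteq> {..<n}" "J \<subseteq> {..<n}" "sum ?f I = sum ?f J" for I J
  proof -
    define c where "c i = (of_bool (i \<in> I) + of_bool (i \<in> J) :: bit)" for i
    have *: "(\<Sum>i<n. scale2 (of_bool (i \<in> A)) (?f i)) = sum ?f A" if "A \<subseteq> {..<n}" for A
      using that by (intro sum.mono_neutral_cong_right) auto
    have "act (?P c) \<alpha> = sum ?f I + sum ?f J"
      unfolding act_P c_def scale2_add_left sum.distrib *[OF that(1)] *[OF that(2)] ..
    hence "c i = 0" if "i < n" for i using P0 that \<open>sum ?f I = _\<close> by (simp add: add_self)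
    hence "i \<in> I \<longleftrightarrow> i \<in> J" if "i < n" for i using that unfolding c_def by (cases "i \<in> I"; cases "i \<in> J") force+
    thus ?thesis using that(1,2) by blast
  qed
  \<comment> \<open>Dependence concerns the set of conjugates, so a relation indexed by
    \<open>i < n\<close> needs them distinct.\<close>
  have inj_f: "inj_on ?f {..<n}"
  proof (rule inj_onI)
    fix i j assume "i \<in> {..<n}" "j \<in> {..<n}" "?f i = ?f j"
    thus "i = j" using Pow_inj[of "{i}" "{j}"] by auto
  qed
  have "\<not> V.dependent (?f ` {..<n})"
  proof
    assume "V.dependent (?f ` {..<n})"
    then obtain u i where "i < n" "u (?f i) \<noteq> 0" "(\<Sum>v\<in>?f ` {..<n}. scale2 (u v) v) = 0"
      using V.dependent_finite[of "?f ` {..<n}"] by auto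
    thus False using P0[of "\<lambda>i. u (?f i)" i] by (simp add: act_P sum.reindex[OF inj_f])
  qed
  moreover have "sum ?f ` Pow {..<n} = UNIV"
  proof (rule card_subset_eq)
    have "inj_on (sum ?f) (Pow {..<n})" by (rule inj_onI, rule Pow_inj) auto
    thus "card (sum ?f ` Pow {..<n}) = card (UNIV :: 'a set)"
      by (simp add: card_image card_Pow card)
  qed auto
  moreover have "sum ?f ` Pow {..<n} \<subseteq> V.span (?f ` {..<n})"
    by (intro image_subsetI V.span_sum V.span_base) auto
  ultimately show ?thesis
    unfolding normal_element_def Let_def \<open>{\<alpha> ^ (2 ^ i) | i. i < n} = _\<close> by blast
qed

text \<open>The hypotheses make the \<open>2 ^ s\<close>-th power of the autocorrelation of \<open>\<alpha>\<close> act as the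
  identity, so the annihilator of \<open>\<alpha>\<close> is trivial.\<close>

lemma normal_element_autocorrelation:
  fixes \<alpha> :: 'a
  assumes card: "card (UNIV :: 'a set) = 2 ^ n" and "n > 0"
    and supp: "\<And>k. trace_form n \<alpha> (frob k \<alpha>) \<noteq> 0 \<Longrightarrow> n dvd k * 2 ^ s"
    and sum: "(\<Sum>k<n. trace_form n \<alpha> (frob k \<alpha>)) = 1"
  shows "normal_element n \<alpha>"
proof (rule normal_elementI[OF card \<open>n > 0\<close>])
  fix p assume deg: "degree p < n" and p: "act p \<alpha> = 0"
  have F [simp]: "x \<in> fixed_field n" for x :: 'a using fixed_field_UNIV[OF card] by simp
  let ?C = "corr n \<alpha> \<alpha>"
  \<comment> \<open>\<open>p\<close> times the autocorrelation acts as
    \<open>corr n (act p \<alpha>) \<alpha>\<close>, which is 0.\<close>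
  have pC: "act p (act ?C x) = 0" for x :: 'a
    using act_corr_act[of \<alpha> n \<alpha> x p] p by (simp add: act_corr)
  have "act p x = 0" for x :: 'a
  proof -
    have "act (?C ^ 2 ^ s) x = (\<Sum>k<n. trace_form n \<alpha> (frob k \<alpha>) * frob (k * 2 ^ s) x)"
      by (simp add: act_power lin_corr)
    also have "\<dots> = (\<Sum>k<n. trace_form n \<alpha> (frob k \<alpha>) * x)"
    proof (rule sum.cong[OF refl])
      fix k
      show "trace_form n \<alpha> (frob k \<alpha>) * frob (k * 2 ^ s) x = trace_form n \<alpha> (frob k \<alpha>) * x"
      proof (cases "trace_form n \<alpha> (frob k \<alpha>) = 0")
        case False
        then obtain l where "k * 2 ^ s = n * l" using supp[of k] by (auto elim: dvdE)
        thus ?thesis by (simp add: frob_mult_period)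
      qed simp
    qed
    also have "\<dots> = x" using sum by (simp flip: sum_distrib_right)
    finally have "act (?C ^ 2 ^ s) x = x" .
    moreover have "?C ^ 2 ^ s = ?C * ?C ^ (2 ^ s - 1)"
      by (simp flip: power_Suc)
    ultimately show ?thesis using pC[of "act (?C ^ (2 ^ s - 1)) x"] by (simp add: act_mult)
  qed
  thus "p = 0" using act_faithful[OF card deg] by blast
qed

text \<open>Descend to degree \<open>N\<close> first: \<open>u\<close> stays fixed, and by
  coprimality the shifts \<open>N * j\<close> run through all residues modulo \<open>m\<close>,
  leaving \<open>u * Tr(v)\<close>.\<close>

lemma trace2_mult:
  fixes u v :: 'a
  assumes "coprime N m" "m > 0" "u \<in> fixed_field N" "v \<in> fixed_field m"
  shows "trace2 (N * m) (u * v) = trace2 N u * trace2 m v"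
proof -
  have "(\<Sum>j<m. frob (N * j) v) = (\<Sum>j<m. frob (N * j mod m) v)"
    by (simp add: frob_mod[OF assms(4)])
  also have "\<dots> = trace2 m v"
    unfolding trace2_frob by (rule sum.reindex_bij_betw[OF bij_betw_mult_mod[OF assms(1,2)]])
  finally have "act (rel_trace N m) (u * v) = u * trace2 m v"
    by (simp add: act_rel_trace frob_mult frob_mult_period[OF assms(3)] flip: sum_distrib_left)
  hence "trace2 (N * m) (u * v) = trace2 N (u * trace2 m v)"
    using trace2_rel_trace by metis
  thus ?thesis using trace2_01[OF assms(4)] by (auto simp: trace2_frob)
qed

end

lemma hamming_weight_map: "hamming_weight (map f [0..<n]) = card {k. k < n \<and> f k \<noteq> 0}"
proof -
  have "hamming_weight (map f [0..<n]) = length (filter (\<lambda>k. f k \<noteq> 0) [0..<n])"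
    by (simp add: hamming_weight_def filter_map o_def)
  also have "\<dots> = card (set (filter (\<lambda>k. f k \<noteq> 0) [0..<n]))"
    by (rule distinct_card[symmetric]) simp
  also have "set (filter (\<lambda>k. f k \<noteq> 0) [0..<n]) = {k. k < n \<and> f k \<noteq> 0}" by auto
  finally show ?thesis .
qed

theorem corollary5p5:
  fixes n :: nat
  assumes "n > 0" and "4 dvd n"
    and "card (UNIV :: 'a :: finite_field set) = 2 ^ n"
  shows "\<exists>\<alpha> :: 'a. normal_element n \<alpha> \<and> hamming_weight (corresponding_vector n \<alpha>) = 3"
proof -
  note char2 = card_eq_power2_imp_CHAR[OF assms(3)]
  obtain s m where n: "n = 2 ^ s * m" and "odd m"
    using multiplicity_decompose'[of n 2] assms(1) by (metis gr_implies_not0 odd_one)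
  define N :: nat where "N = 2 ^ s"
  have "coprime 4 m" using coprime_power_left_iff[of 2 2 m] \<open>odd m\<close> by simp
  hence "4 dvd (2 ^ s :: nat)" using assms(2) unfolding n by (simp add: coprime_dvd_mult_left_iff)
  hence "2 ^ 2 dvd (2 ^ s :: nat)" by simp
  hence s: "s \<ge> 2" by (rule power_dvd_imp_le) simp
  have "N \<ge> 2 ^ 2" unfolding N_def using s by (intro power_increasing) auto
  hence N4: "N \<ge> 4" by simp
  have "m > 0" using \<open>odd m\<close> by (auto intro: Nat.gr0I)
  have cop: "coprime N m" "coprime m N" using \<open>odd m\<close> by (simp_all add: N_def)
  have nN: "n = N * m" "n = m * N" using n by (simp_all add: N_def)
  obtain \<beta> :: 'a where \<beta>: "\<beta> \<in> fixed_field N" "\<And>i. trace_form N \<beta> (frob i \<beta>) = weight3_pattern N i"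
    using exists_weight3_autocorrelation[OF char2 N_def s, of m] assms(3) \<open>m > 0\<close> nN by auto
  obtain \<gamma> :: 'a where \<gamma>: "\<gamma> \<in> fixed_field m"
      "\<And>k. trace_form m \<gamma> (frob k \<gamma>) = (if m dvd k then 1 else 0)"
    using exists_self_dual_normal[OF char2, of m N] assms(3) N4 nN \<open>odd m\<close> by auto
  define \<alpha> where "\<alpha> = \<beta> * \<gamma>"
  let ?c = "\<lambda>k. trace_form n \<alpha> (frob k \<alpha>)"
  \<comment> \<open>The trace of the product splits, so the support is cut out by one condition
    modulo \<open>m\<close> and one modulo \<open>N\<close>.\<close>
  have c: "?c k = (if m dvd k \<and> k mod N \<in> {0, 1, N - 1} then 1 else 0)" for k
  proof -
    have "?c k = trace2 (N * m) ((\<beta> * frob k \<beta>) * (\<gamma> * frob k \<gamma>))"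
      by (simp add: trace_form_def \<alpha>_def frob_mult nN(1) ac_simps)
    also have "\<dots> = trace_form N \<beta> (frob k \<beta>) * trace_form m \<gamma> (frob k \<gamma>)"
      unfolding trace_form_def
      by (intro trace2_mult[OF char2 cop(1) \<open>m > 0\<close>] fixed_field_times fixed_field_frob \<beta>(1) \<gamma>(1))
    finally show ?thesis by (simp add: \<beta>(2) \<gamma>(2) weight3_pattern_def)
  qed
  have card3: "card {k. k < n \<and> ?c k \<noteq> 0} = 3"
  proof -
    \<comment> \<open>Write \<open>k = m * j\<close> with \<open>j < N\<close>; multiplication by
      \<open>m\<close> permutes the residues modulo \<open>N\<close>, so three values of
      \<open>j\<close> qualify.\<close>
    let ?T = "{0, 1, N - 1}" and ?J = "{j. j < N \<and> m * j mod N \<in> {0, 1, N - 1}}"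
    have "{k. k < n \<and> ?c k \<noteq> 0} = (\<lambda>j. m * j) ` ?J"
      unfolding c using \<open>m > 0\<close> by (auto simp: nN(2) split: if_splits)
    hence "card {k. k < n \<and> ?c k \<noteq> 0} = card ?J"
      using \<open>m > 0\<close> by (simp add: card_image inj_on_def)
    also have "card ?J = card ?T"
    proof (rule bij_betw_same_card, rule bij_betw_subset)
      show bij: "bij_betw (\<lambda>j. m * j mod N) {..<N} {..<N}"
        by (rule bij_betw_mult_mod[OF cop(2)]) (use N4 in simp)
      have "f ` {j. j < N \<and> f j \<in> T} = T" if "T \<subseteq> f ` {..<N}" for f :: "nat \<Rightarrow> nat" and T
        using that by blast
      thus "(\<lambda>j. m * j mod N) ` ?J = ?T"
        by this (use bij N4 in \<open>auto simp: bij_betw_def\<close>)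
    qed auto
    also have "card ?T = 3" using N4 by simp
    finally show ?thesis .
  qed
  have "(\<Sum>k<n. ?c k) = (\<Sum>k\<in>{k. k < n \<and> ?c k \<noteq> 0}. 1)"
    by (rule sum.mono_neutral_cong_right) (auto simp: c split: if_splits)
  also have "\<dots> = of_nat 3" using card3 by simp
  also have "\<dots> = 1" by (rule of_nat_odd[OF char2]) simp
  finally have sum: "(\<Sum>k<n. ?c k) = 1" .
  have "n dvd k * 2 ^ s" if "?c k \<noteq> 0" for k
    using that unfolding c by (auto simp: n mult.commute split: if_splits)
  hence "normal_element n \<alpha>"
    by (rule normal_element_autocorrelation[OF char2 assms(3,1) _ sum])
  moreover have "hamming_weight (corresponding_vector n \<alpha>) = 3"
    using card3 by (simp add: corresponding_vector_def hamming_weight_map trace_form_def frob_def)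
  ultimately show ?thesis by blast
qed

end
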